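(* Let the integral system $S[R_1,R_2]$ be limit circle at $b$. Then for every $\mathbf{u}=[\pi u_1\ \pi f]^T\in T_N^*$ (with $(u_1,u_2,f)\in\mathcal{T}$ the corresponding triple) one has $u_2\in\mathcal{L}^2(R_1)$ and the following two equalities hold: $$\lim_{x\to b}u_1(x)=u_1(0)+\int_0^b f R_1\,dR_2,\qquad \lim_{x\to b}u_1(x)u_2(x)=0.$$ Moreover, if $\mathbf{u}=[\pi u_1\ \pi f]^T\in T_{\max}$, the endpoint $b$ is singular, and $\lim_{x\to b}u_1(x)u_2(x)=0$, then $\mathbf{u}\in T_N^*$.
   Context: **Integral systems.** Let $0<b\le\infty$ and let $R_1,R_2:[0,b)\to\mathbb{R}$ be nondecreasing left-continuous functions with $R_1(0)=R_2(0)=0$; put $R_j(b):=\lim_{x\to b}R_j(x)\in[0,\infty]$. $dR_j$ is the Lebesgue-Stieltjes measure of $R_j$ on $[0,b)$. Convention: $\int_a^x f\,d\sigma:=\int_{[a,x)}f\,d\sigma$. The integral system $S[R_1,R_2]$ with spectral parameter $\lambda\in\mathbb{C}$ is $$u_1(x)=u_1(0)+\int_0^x u_2\,dR_1,\qquad u_2(x)=u_2(0)-\lambda\int_0^x u_1\,dR_2,\qquad x\in[0,b).$$ It is regular (at $b$) if $R_1(b)+R_2(b)<\infty$, and singular otherwise. **Standing assumptions.** $R_1$ and $R_2$ have no common points of discontinuity; and there is an interval $[0,b_0)\subseteq[0,b)$ such that the classes of $1$ and $R_1$ in $L^2(R_2,[0,b_0))$ are linearly independent. **Linear relations.** $\mathcal{L}^2(R_j)$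 is the space of complex functions with $\int_{[0,b)}|f|^2dR_j<\infty$; $L^2(R_2)$ is the quotient of $\mathcal{L}^2(R_2)$ modulo $dR_2$-a.e. equality, with quotient map $\pi$. $\mathcal{T}$ is the set of triples $(u_1,u_2,f)$ with $f,u_1\in\mathcal{L}^2(R_2)$ and $u_1(x)=u_1(0)+\int_0^xu_2\,dR_1$, $u_2(x)=u_2(0)-\int_0^xf\,dR_2$ for all $x\in[0,b)$. $T_{\max}=\{[\pi u_1\ \pi f]^T:(u_1,u_2,f)\in\mathcal{T}\}$. Under the standing assumptions the values $u_1(x),u_2(x)$ are uniquely determined by the element $[\pi u_1\ \pi f]^T\in T_{\max}$. For $\lambda\in\mathbb{C}\setminus\mathbb{R}$, the system is limit point at $b$ if $\dim\ker(T_{\max}-\lambda I)=1$ and limit circle at $b$ if $\dim\ker(T_{\max}-\lambda I)=2$ (one of the two holds, independently of $\lambda$). In the limit circle case the limit $u_2(b):=\lim_{x\to b}u_2(x)=u_2(0)-\int_0^bf\,dR_2$ exists for every element of $T_{\max}$. The relation $T_N$ is $$T_N=\{[\pi u_1\ \pi f]^T:(u_1,u_2,f)\in\mathcal{T},\ u_1(0)=u_2(0)=u_2(b)=0\},$$ and its adjoint is $$T_N^*=\{[\pi u_1\ \pi f]^T:(u_1,u_2,f)\in\mathcal{T},\ u_2(b)=0\}.$$ *)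

theory Defs
  imports "HOL-Analysis.Analysis"
begin

section \<open>Lebesgue--Stieltjes measures on \<open>[0,b)\<close>\<close>

text \<open>Functions on \<open>[0,b)\<close> are represented by total functions on \<^typ>\<open>real\<close>; none of the notions below
  depends on their values outside \<open>[0,b)\<close>.\<close>

definition ray :: "ereal \<Rightarrow> real set" where
  "ray b = {x. 0 \<le> x \<and> ereal x < b}"

text \<open>The filter \<open>x \<rightarrow> b\<close>, for \<open>0 < b \<le> \<infinity>\<close>.\<close>

definition at_end :: "ereal \<Rightarrow> real filter" where
  "at_end b = (if b = \<infinity> then at_top else at_left (real_of_ereal b))"

text \<open>\<^const>\<open>interval_measure\<close> is the measure with \<open>(x,y] \<mapsto> F y - F x\<close> for right-continuous \<open>F\<close>
  on the whole line. For left-continuous \<open>R\<close> on \<open>[0,b)\<close>, possibly unbounded even when \<open>b\<close> is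
  finite, the half-open intervals are closed on the left; in particular \<open>{0}\<close> has mass
  \<open>R(0+) - R(0)\<close>.\<close>

definition LS :: "ereal \<Rightarrow> (real \<Rightarrow> real) \<Rightarrow> real measure" where
  "LS b R = extend_measure (ray b) {(x, y). 0 \<le> x \<and> x \<le> y \<and> ereal y < b}
     (\<lambda>(x, y). {x..<y}) (\<lambda>(x, y). ennreal (R y - R x))"

text \<open>The extension demanded in \<^const>\<open>LS\<close> exists; without it \<^const>\<open>extend_measure\<close> would return the zero measure.\<close>

lemma LS_emeasure:
  assumes "0 < b" and m: "mono_on (ray b) R"
    and lc: "\<And>x. x \<in> ray b \<Longrightarrow> continuous (at x within {0..x}) R"
    and xy: "0 \<le> x" "x \<le> y" "ereal y < b"
  shows "emeasure (LS b R) {x..<y} = ennreal (R y - R x)"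
proof -
  have less_b: "s \<le> t \<Longrightarrow> ereal t < b \<Longrightarrow> ereal s < b" for s t
    by (meson ereal_less_eq(3) order_le_less_trans)
  obtain X :: "nat \<Rightarrow> real" where X: "incseq X" "\<And>i. 0 < ereal (X i)" "\<And>i. X i < b" "X \<longlonglongrightarrow> b"
    using ereal_incseq_approx[OF \<open>0 < b\<close>] by blast
  define c where "c n = (case n of 0 \<Rightarrow> 0 | Suc k \<Rightarrow> X k)" for n
  have c0: "c 0 = 0" by (simp add: c_def)
  have cle: "c n \<le> c (Suc n)" for n
    using X(1,2) by (cases n) (auto simp: c_def incseq_SucD less_imp_le)
  have c_ray: "0 \<le> c n" "ereal (c n) < b" for n
    using X(2,3) \<open>0 < b\<close> by (cases n; force simp: c_def zero_ereal_def intro: less_imp_le)+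
  define k where "k n t = max (c n) (min t (c (Suc n)))" for n t
  have k_mono: "s \<le> t \<Longrightarrow> k n s \<le> k n t" for n s t by (auto simp: k_def)
  have k_ge: "0 \<le> k n t" for n t using c_ray[of n] by (auto simp: k_def)
  have k_lt: "ereal (k n t) < b" for n t
    using less_b[OF _ c_ray(2)[of "Suc n"], of "k n t"] cle[of n] by (auto simp: k_def)
  have k_ray: "k n t \<in> ray b" for n t using k_ge k_lt by (simp add: ray_def)
  define F where "F n t = - R (k n (- t))" for n t
  have F_mono: "s \<le> t \<Longrightarrow> F n s \<le> F n t" for n s t
    unfolding F_def using mono_onD[OF m k_ray k_ray k_mono[of "- t" "- s" n]] by simp
  have F_cont: "continuous (at_right a) (F n)" for n a
  proof -
    have "((\<lambda>t. R (k n (- t))) \<longlongrightarrow> R (k n (- a))) (at_right a)"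
    proof (rule continuous_within_tendsto_compose[OF lc[OF k_ray]])
      show "((\<lambda>t. k n (- t)) \<longlongrightarrow> k n (- a)) (at_right a)"
        unfolding k_def by (intro tendsto_intros)
      show "\<forall>\<^sub>F t in at_right a. k n (- t) \<in> {0..k n (- a)}"
        using k_ge k_mono by (auto simp: eventually_at_filter)
    qed
    then show ?thesis unfolding F_def continuous_within by (intro tendsto_intros)
  qed
  define N where "N n = distr (interval_measure (F n)) borel uminus" for n
  have setsN: "sets (N n) = sets borel" for n by (simp add: N_def)
  have N: "emeasure (N n) {s..<t} = ennreal (R (k n t) - R (k n s))" if "s \<le> t" for n s t
  proof -
    have "uminus -` {s..<t} = {- t <.. - s}" by auto
    then show ?thesis unfolding N_def using that F_mono F_cont
      by (subst emeasure_distr) (auto simp: emeasure_interval_measure_Ioc F_def)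
  qed
  define mu where "mu A = (\<integral>\<^sup>+n. emeasure (N n) A \<partial>count_space UNIV)" for A
  have c_exceeds: "\<exists>m. t < c (Suc m)" if "ereal t < b" for t
  proof -
    have "\<forall>\<^sub>F i in sequentially. ereal t < ereal (X i)" using X(4) that by (auto dest: order_tendstoD)
    then show ?thesis by (auto simp: c_def eventually_sequentially)
  qed
  have sub: "sets (LS b R) \<subseteq> sets borel"
  proof
    have "ray b = (\<Union>M. {0..<c (Suc M)})"
      using c_exceeds by (auto simp: ray_def intro: less_b[OF less_imp_le c_ray(2)])
    then have ray_borel: "ray b \<in> sets borel" by simp
    fix A assume "A \<in> sets (LS b R)"
    then have "A \<in> sigma_sets (ray b) ((\<lambda>(x, y). {x..<y}) ` {(x, y). 0 \<le> x \<and> x \<le> y \<and> ereal y < b})"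
      unfolding LS_def by (subst (asm) sets_extend_measure) (auto simp: ray_def intro: less_b[OF less_imp_le])
    then show "A \<in> sets borel"
      by induction (use ray_borel in auto)
  qed
  show ?thesis
  proof (rule emeasure_extend_measure_Pair[where \<mu>' = mu, OF LS_def])
    fix s t :: real assume st: "0 \<le> s \<and> s \<le> t \<and> ereal t < b"
    obtain m where "t < c (Suc m)" using c_exceeds st by blast
    then obtain M where M: "t < c M" by blast
    have S: "(\<Sum>n<L. R (k n u) - R (c n)) = R (min u (c L)) - R 0" if "0 \<le> u" for u L
    proof (induction L)
      case (Suc L)
      have "k L u = c L \<and> min u (c L) = u \<and> min u (c (Suc L)) = u \<or> k L u = min u (c (Suc L)) \<and> min u (c L) = c L"
        using cle[of L] by (auto simp: k_def)
      then show ?case using Suc by auto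
    qed (use c0 that in simp)
    have cM: "n \<ge> M \<Longrightarrow> c M \<le> c n" for n using cle by (simp add: lift_Suc_mono_le)
    have z: "k n t = k n s" if "n \<ge> M" for n
      using cM[OF that] M st by (auto simp: k_def)
    have "mu {s..<t} = (\<Sum>n. ennreal (R (k n t) - R (k n s)))"
      unfolding mu_def using st by (simp add: nn_integral_count_space_nat N)
    also have "\<dots> = (\<Sum>n<M. ennreal (R (k n t) - R (k n s)))"
      by (rule suminf_finite) (auto simp: z not_less)
    also have "\<dots> = ennreal (\<Sum>n<M. R (k n t) - R (k n s))"
      using st mono_onD[OF m k_ray k_ray k_mono] by (intro sum_ennreal) auto
    also have "(\<Sum>n<M. R (k n t) - R (k n s)) = (\<Sum>n<M. R (k n t) - R (c n)) - (\<Sum>n<M. R (k n s) - R (c n))"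
      by (simp add: sum_subtractf)
    also have "\<dots> = R t - R s" using st M by (simp add: S)
    finally show "mu {s..<t} = ennreal (R t - R s)" .
  next
    show "positive (sets (LS b R)) mu" by (simp add: positive_def mu_def)
    show "countably_additive (sets (LS b R)) mu"
    proof (rule countably_additiveI)
      fix A :: "nat \<Rightarrow> real set"
      assume A: "range A \<subseteq> sets (LS b R)" "disjoint_family A"
      then have "range A \<subseteq> sets (N n)" for n using sub setsN by auto
      with A show "(\<Sum>i. mu (A i)) = mu (\<Union>i. A i)"
        unfolding mu_def by (subst nn_integral_suminf[symmetric]) (auto simp: suminf_emeasure)
    qed
  qed (use xy in \<open>auto simp: ray_def intro: less_b[OF less_imp_le]\<close>)
qed

definition integral_system :: "ereal \<Rightarrow> (real \<Rightarrow> real) \<Rightarrow> (real \<Rightarrow> real) \<Rightarrow> bool" where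
  "integral_system b R1 R2 \<longleftrightarrow> 0 < b \<and>
     (\<forall>R\<in>{R1, R2}. R 0 = 0 \<and> mono_on (ray b) R \<and>
        (\<forall>x\<in>ray b. continuous (at x within {0..x}) R))"

definition R_end :: "ereal \<Rightarrow> (real \<Rightarrow> real) \<Rightarrow> ennreal" where
  "R_end b R = Lim (at_end b) (\<lambda>x. ennreal (R x))"

definition regular_at_end :: "ereal \<Rightarrow> (real \<Rightarrow> real) \<Rightarrow> (real \<Rightarrow> real) \<Rightarrow> bool" where
  "regular_at_end b R1 R2 \<longleftrightarrow> R_end b R1 + R_end b R2 < \<infinity>"

abbreviation singular_at_end :: "ereal \<Rightarrow> (real \<Rightarrow> real) \<Rightarrow> (real \<Rightarrow> real) \<Rightarrow> bool" where
  "singular_at_end b R1 R2 \<equiv> \<not> regular_at_end b R1 R2"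

section \<open>The spaces \<open>\<L>\<^sup>2\<close> and \<open>L\<^sup>2\<close>\<close>

definition sq_int :: "real measure \<Rightarrow> (real \<Rightarrow> complex) set" where
  "sq_int M = {f \<in> borel_measurable M. integrable M (\<lambda>x. (cmod (f x))\<^sup>2)}"

text \<open>The quotient map \<open>\<pi>\<close>; an element of \<open>L\<^sup>2\<close> is an equivalence class of functions in \<open>\<L>\<^sup>2\<close>.\<close>

definition cls :: "real measure \<Rightarrow> (real \<Rightarrow> complex) \<Rightarrow> (real \<Rightarrow> complex) set" where
  "cls M f = {g \<in> sq_int M. AE x in M. g x = f x}"

type_synonym L2_class = "(real \<Rightarrow> complex) set"

text \<open>Linear independence of the classes of \<open>\<phi> 0, \<dots>, \<phi> (n - 1)\<close> in \<open>L\<^sup>2\<close>.\<close>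

definition cls_independent :: "real measure \<Rightarrow> nat \<Rightarrow> (nat \<Rightarrow> real \<Rightarrow> complex) \<Rightarrow> bool" where
  "cls_independent M n \<phi> \<longleftrightarrow> (\<forall>i<n. \<phi> i \<in> sq_int M) \<and>
     (\<forall>c :: nat \<Rightarrow> complex. cls M (\<lambda>x. \<Sum>i<n. c i * \<phi> i x) = cls M (\<lambda>_. 0) \<longrightarrow> (\<forall>i<n. c i = 0))"

text \<open>The set \<open>V\<close> is a linear subspace of \<open>L\<^sup>2\<close> with a basis of \<open>n\<close> elements, i.e. \<open>dim V = n\<close>.\<close>

definition cls_dim :: "real measure \<Rightarrow> L2_class set \<Rightarrow> nat \<Rightarrow> bool" where
  "cls_dim M V n \<longleftrightarrow> (\<exists>\<phi>. cls_independent M n \<phi> \<and>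
     V = {cls M (\<lambda>x. \<Sum>i<n. c i * \<phi> i x) | c :: nat \<Rightarrow> complex. True})"

section \<open>Linear relations in \<open>L\<^sup>2\<close>\<close>

type_synonym relation = "(L2_class \<times> L2_class) set"

definition rel_minus :: "real measure \<Rightarrow> relation \<Rightarrow> complex \<Rightarrow> relation" where
  "rel_minus M T z = {(cls M u, cls M (\<lambda>x. f x - z * u x)) | u f.
     u \<in> sq_int M \<and> f \<in> sq_int M \<and> (cls M u, cls M f) \<in> T}"

definition rel_ker :: "real measure \<Rightarrow> relation \<Rightarrow> L2_class set" where
  "rel_ker M T = {U. (U, cls M (\<lambda>_. 0)) \<in> T}"

definition inner_L2 :: "real measure \<Rightarrow> (real \<Rightarrow> complex) \<Rightarrow> (real \<Rightarrow> complex) \<Rightarrow> complex" where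
  "inner_L2 M f g = (LINT x|M. f x * cnj (g x))"

definition rel_adjoint :: "real measure \<Rightarrow> relation \<Rightarrow> relation" where
  "rel_adjoint M T = {(cls M v, cls M g) | v g. v \<in> sq_int M \<and> g \<in> sq_int M \<and>
     (\<forall>u\<in>sq_int M. \<forall>f\<in>sq_int M. (cls M u, cls M f) \<in> T \<longrightarrow> inner_L2 M f v = inner_L2 M u g)}"

section \<open>The relations of an integral system\<close>

definition standing_assumptions :: "ereal \<Rightarrow> (real \<Rightarrow> real) \<Rightarrow> (real \<Rightarrow> real) \<Rightarrow> bool" where
  "standing_assumptions b R1 R2 \<longleftrightarrow>
     (\<forall>x\<in>ray b. continuous (at x within ray b) R1 \<or> continuous (at x within ray b) R2) \<and>
     (\<exists>b0. 0 < b0 \<and> b0 \<le> b \<and>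
        cls_independent (LS b0 R2) 2 (\<lambda>i x. if i = 0 then 1 else complex_of_real (R1 x)))"

text \<open>All integrals below are Lebesgue integrals over \<open>[0,x)\<close>. They converge absolutely: \<open>f\<close> is
  square integrable and \<open>dR\<^sub>2\<close> is finite on \<open>[0,x)\<close>, so \<open>u\<^sub>2\<close> is bounded and measurable there.\<close>

definition triples ::
  "ereal \<Rightarrow> (real \<Rightarrow> real) \<Rightarrow> (real \<Rightarrow> real) \<Rightarrow> ((real \<Rightarrow> complex) \<times> (real \<Rightarrow> complex) \<times> (real \<Rightarrow> complex)) set"
where
  "triples b R1 R2 = {(u1, u2, f). u1 \<in> sq_int (LS b R2) \<and> f \<in> sq_int (LS b R2) \<and>
     (\<forall>x\<in>ray b. u1 x = u1 0 + (LINT t:{0..<x}|LS b R1. u2 t) \<and>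
                u2 x = u2 0 - (LINT t:{0..<x}|LS b R2. f t))}"

definition T_max :: "ereal \<Rightarrow> (real \<Rightarrow> real) \<Rightarrow> (real \<Rightarrow> real) \<Rightarrow> relation" where
  "T_max b R1 R2 = {(cls (LS b R2) u1, cls (LS b R2) f) | u1 u2 f. (u1, u2, f) \<in> triples b R1 R2}"

text \<open>The dimension does not depend on the choice of the non-real number \<open>z\<close>.\<close>

definition limit_circle :: "ereal \<Rightarrow> (real \<Rightarrow> real) \<Rightarrow> (real \<Rightarrow> real) \<Rightarrow> bool" where
  "limit_circle b R1 R2 \<longleftrightarrow>
     (\<exists>z. z \<notin> \<real> \<and> cls_dim (LS b R2) (rel_ker (LS b R2) (rel_minus (LS b R2) (T_max b R1 R2) z)) 2)"

definition T_N :: "ereal \<Rightarrow> (real \<Rightarrow> real) \<Rightarrow> (real \<Rightarrow> real) \<Rightarrow> relation" where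
  "T_N b R1 R2 = {(cls (LS b R2) u1, cls (LS b R2) f) | u1 u2 f.
     (u1, u2, f) \<in> triples b R1 R2 \<and> u1 0 = 0 \<and> u2 0 = 0 \<and> (u2 \<longlongrightarrow> 0) (at_end b)}"

abbreviation T_N_adjoint :: "ereal \<Rightarrow> (real \<Rightarrow> real) \<Rightarrow> (real \<Rightarrow> real) \<Rightarrow> relation" where
  "T_N_adjoint b R1 R2 \<equiv> rel_adjoint (LS b R2) (T_N b R1 R2)"

end

theory Submission
  imports Defs
begin

text \<open>Everything rests on two identities for \<open>u\<^sub>1 = u\<^sub>1(0) + \<integral> u\<^sub>2 dR\<^sub>1\<close>,
  \<open>u\<^sub>2 = u\<^sub>2(0) - \<integral> f dR\<^sub>2\<close>. Because \<open>R\<^sub>1\<close> and \<open>R\<^sub>2\<close> never jump together, integration by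
  parts holds without a diagonal term (\<open>integration_by_parts\<close>), which gives the Lagrange identity
  \<open>[u\<^sub>1 v\<^sub>2 - u\<^sub>2 v\<^sub>1]\<close> from \<open>0\<close> to \<open>x\<close> \<open>= \<integral> (f v\<^sub>1 - u\<^sub>1 g) dR\<^sub>2\<close> over \<open>[0,x)\<close> and, with \<open>(v\<^sub>1, v\<^sub>2, g) = (R\<^sub>1, 1, 0)\<close>,
  the formula \<open>u\<^sub>1(x) = u\<^sub>1(0) + R\<^sub>1(x) u\<^sub>2(x) + \<integral> f R\<^sub>1 dR\<^sub>2\<close>, the integral again over \<open>[0,x)\<close>
  (\<open>first_component_formula\<close>).

  The limit circle property enters through \<open>1, R\<^sub>1 \<in> L\<^sup>2(R\<^sub>2)\<close>, the two solutions for
  \<open>\<lambda> = 0\<close>. If all solutions for one \<open>z\<close> are square integrable, variation of constants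
  bounds a solution \<open>w\<close> for \<open>\<lambda> = 0\<close> by \<open>|w\<^sub>1(x)| \<le> g(x) (1 + \<integral> |w\<^sub>1| g dR\<^sub>2)\<close> over \<open>[0,x)\<close> with
  \<open>g \<in> L\<^sup>2(R\<^sub>2)\<close>, and a Gronwall argument yields \<open>w\<^sub>1 \<in> L\<^sup>2(R\<^sub>2)\<close> (\<open>limit_circle_sq_int\<close>).

  Now let \<open>u\<^sub>2(b) = 0\<close>, that is \<open>u\<^sub>2(x) = \<integral> f dR\<^sub>2\<close> over \<open>[x,b)\<close>. Then \<open>R\<^sub>1(x) |u\<^sub>2(x)|\<close> is at most the tail
  \<open>\<integral> |f| R\<^sub>1 dR\<^sub>2\<close> over \<open>[x,b)\<close>, which tends to \<open>0\<close> since \<open>f R\<^sub>1\<close> is integrable; so the formula for \<open>u\<^sub>1\<close>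
  gives the first limit, and then \<open>u\<^sub>1 u\<^sub>2 \<rightarrow> 0\<close>. The same formula with \<open>|f|\<close> in place of \<open>f\<close> shows
  that the tails of \<open>|f|\<close> are \<open>R\<^sub>1\<close>-integrable, hence \<open>u\<^sub>2 \<in> L\<^sup>2(R\<^sub>1)\<close>. Conversely, if \<open>u\<^sub>1 u\<^sub>2 \<rightarrow> 0\<close> but
  \<open>u\<^sub>2(b) \<noteq> 0\<close>, then \<open>u\<^sub>1 \<rightarrow> 0\<close>, and solving the formula for \<open>R\<^sub>1\<close> shows that \<open>R\<^sub>1\<close> converges; as
  \<open>R\<^sub>2\<close> is bounded too, \<open>b\<close> is regular.

  It remains to identify the adjoint of \<open>T\<^sub>N\<close> with the condition \<open>u\<^sub>2(b) = 0\<close>. One inclusion is the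
  Lagrange identity in the limit \<open>x \<rightarrow> b\<close>. For the other, \<open>T\<^sub>N\<close> contains an element with
  right-hand side \<open>f\<close> for every \<open>f \<in> L\<^sup>2(R\<^sub>2)\<close> of mean zero; a pair \<open>(v, g)\<close> in the adjoint is compared
  with the explicit solution \<open>h\<close> for the right-hand side \<open>g\<close> with \<open>h\<^sub>2(b) = 0\<close>, and \<open>v - h\<^sub>1\<close>
  is orthogonal to all such \<open>f\<close>, hence constant.\<close>

section \<open>The ray and the filter at its end\<close>

text \<open>A description common to both cases of the filter; with it, finite and infinite \<open>b\<close> need not be
  distinguished below.\<close>

lemma eventually_at_end:
  assumes "0 < b"
  shows "eventually P (at_end b) \<longleftrightarrow> (\<exists>a\<in>ray b. \<forall>x\<in>ray b. a \<le> x \<longrightarrow> P x)"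
proof (cases b)
  case (real r)
  then have "0 < r" using assms by simp
  show ?thesis
  proof
    assume "eventually P (at_end b)"
    then obtain c where c: "c < r" "\<And>x. c < x \<Longrightarrow> x < r \<Longrightarrow> P x"
      using real eventually_at_left[OF \<open>0 < r\<close>] by (auto simp: at_end_def eventually_at_left_field)
    have "(max 0 c + r) / 2 \<in> ray b" "c < (max 0 c + r) / 2"
      using c(1) \<open>0 < r\<close> by (auto simp: ray_def real max_def)
    then show "\<exists>a\<in>ray b. \<forall>x\<in>ray b. a \<le> x \<longrightarrow> P x"
      using c(2) by (intro bexI[of _ "(max 0 c + r) / 2"]) (auto simp: ray_def real)
  next
    assume "\<exists>a\<in>ray b. \<forall>x\<in>ray b. a \<le> x \<longrightarrow> P x"
    then obtain a where "0 \<le> a" "a < r" "\<And>x. a \<le> x \<Longrightarrow> x < r \<Longrightarrow> P x"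
      by (auto simp: ray_def real)
    then show "eventually P (at_end b)"
      using real by (auto simp: at_end_def eventually_at_left_field intro!: exI[of _ a])
  qed
next
  case PInf
  show ?thesis
  proof
    assume "eventually P (at_end b)"
    then obtain N where N: "\<And>x. N \<le> x \<Longrightarrow> P x"
      by (auto simp: at_end_def PInf eventually_at_top_linorder)
    then show "\<exists>a\<in>ray b. \<forall>x\<in>ray b. a \<le> x \<longrightarrow> P x"
      by (intro bexI[of _ "max 0 N"]) (auto simp: ray_def PInf)
  next
    assume "\<exists>a\<in>ray b. \<forall>x\<in>ray b. a \<le> x \<longrightarrow> P x"
    then obtain a where "0 \<le> a" "\<And>x. a \<le> x \<Longrightarrow> P x"
      by (auto simp: ray_def PInf)
    then show "eventually P (at_end b)"
      by (auto simp: at_end_def PInf eventually_at_top_linorder)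
  qed
qed (use assms in auto)

lemma at_end_neq_bot: "0 < b \<Longrightarrow> at_end b \<noteq> bot"
  unfolding trivial_limit_def by (auto simp: eventually_at_end)

lemma zero_in_ray: "0 < b \<Longrightarrow> 0 \<in> ray b"
  by (simp add: ray_def zero_ereal_def)

lemma eventually_in_ray: "0 < b \<Longrightarrow> \<forall>\<^sub>F x in at_end b. x \<in> ray b"
  using zero_in_ray[of b] by (auto simp: eventually_at_end)

lemma ray_downward: "x \<in> ray b \<Longrightarrow> 0 \<le> t \<Longrightarrow> t \<le> x \<Longrightarrow> t \<in> ray b"
  by (auto simp: ray_def intro: le_less_trans[of "ereal t" "ereal x" b])

lemma ray_borel: "ray b \<in> sets borel"
proof -
  have "{x. ereal x < b} \<in> sets borel"
    by measurable
  moreover have "ray b = {0..} \<inter> {x. ereal x < b}"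
    by (auto simp: ray_def)
  ultimately show ?thesis
    by (metis atLeast_borel sets.Int)
qed

lemma ray_exhaustion:
  assumes "0 < b"
  obtains c :: "nat \<Rightarrow> real"
  where "incseq c" "\<And>n. c n \<in> ray b" "\<And>x. x \<in> ray b \<Longrightarrow> \<exists>n. x < c n"
proof -
  obtain X :: "nat \<Rightarrow> real" where X: "incseq X" "\<And>i. 0 < ereal (X i)" "\<And>i. X i < b" "X \<longlonglongrightarrow> b"
    using ereal_incseq_approx[OF assms] by blast
  have "\<exists>n. x < X n" if "x \<in> ray b" for x
  proof -
    have "\<forall>\<^sub>F i in sequentially. ereal x < ereal (X i)"
      using X(4) that by (auto dest: order_tendstoD simp: ray_def)
    then show ?thesis by (auto simp: eventually_sequentially)
  qed
  then show ?thesis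
    using X by (intro that[of X]) (auto simp: ray_def less_imp_le)
qed

section \<open>Lebesgue--Stieltjes measures of left-continuous functions\<close>

locale stieltjes =
  fixes b :: ereal and R :: "real \<Rightarrow> real"
  assumes b_pos: "0 < b"
    and R_zero: "R 0 = 0"
    and R_mono: "mono_on (ray b) R"
    and R_left_cont: "\<And>x. x \<in> ray b \<Longrightarrow> continuous (at x within {0..x}) R"
begin

abbreviation M :: "real measure" where "M \<equiv> LS b R"

lemma Ico_subset_ray: "y \<in> ray b \<Longrightarrow> 0 \<le> x \<Longrightarrow> {x..<y} \<subseteq> ray b"
  by (auto intro: ray_downward[of y])

lemma generators_subset: "(\<lambda>(x, y). {x..<y}) ` {(x, y). 0 \<le> x \<and> x \<le> y \<and> ereal y < b} \<subseteq> Pow (ray b)"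
proof clarify
  fix x y t :: real assume "0 \<le> x" "x \<le> y" "ereal y < b" "t \<in> {x..<y}"
  then show "t \<in> ray b" using Ico_subset_ray[of y x] by (auto simp: ray_def)
qed

lemma space_LS [simp]: "space M = ray b"
  unfolding LS_def using generators_subset by (rule space_extend_measure)

lemma sets_LS_generated:
  "sets M = sigma_sets (ray b) ((\<lambda>(x, y). {x..<y}) ` {(x, y). 0 \<le> x \<and> x \<le> y \<and> ereal y < b})"
  unfolding LS_def using generators_subset by (rule sets_extend_measure)

lemma sets_LS_Ico: "0 \<le> x \<Longrightarrow> x \<le> y \<Longrightarrow> ereal y < b \<Longrightarrow> {x..<y} \<in> sets M"
  unfolding sets_LS_generated by (rule sigma_sets.Basic) auto

lemma measurable_identity: "(\<lambda>x. x) \<in> borel_measurable M"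
proof (rule borel_measurableI_less)
  fix y :: real
  consider "y \<le> 0" | "0 \<le> y" "ereal y < b" | "b \<le> ereal y" by force
  then show "{x \<in> space M. x < y} \<in> sets M"
  proof cases
    case 1
    then have "{x \<in> space M. x < y} = {}" by (auto simp: ray_def)
    then show ?thesis by (simp only: sets.empty_sets)
  next
    case 2
    then have "{x \<in> space M. x < y} = {0..<y}"
      by (auto simp: ray_def intro: less_trans[of "ereal _" "ereal y"])
    then show ?thesis using 2 sets_LS_Ico[of 0 y] by simp
  next
    case 3
    then have "{x \<in> space M. x < y} = space M"
      by (auto simp: ray_def dest: less_le_trans)
    then show ?thesis by (metis sets.top)
  qed
qed

lemma sets_LS: "sets M = sets (restrict_space borel (ray b))"
proof
  have "(\<lambda>(x, y). {x..<y}) ` {(x, y). 0 \<le> x \<and> x \<le> y \<and> ereal y < b} \<subseteq> sets (restrict_space borel (ray b))"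
  proof
    fix A assume A: "A \<in> (\<lambda>(x, y). {x..<y}) ` {(x, y). 0 \<le> x \<and> x \<le> y \<and> ereal y < b}"
    then have "A \<in> sets borel" "A \<subseteq> ray b" using generators_subset by auto
    then show "A \<in> sets (restrict_space borel (ray b))"
      using ray_borel by (simp add: sets_restrict_space_iff)
  qed
  then show "sets M \<subseteq> sets (restrict_space borel (ray b))"
    unfolding sets_LS_generated
    using sets.sigma_sets_subset[of _ "restrict_space borel (ray b)"] by (simp add: space_restrict_space)
next
  show "sets (restrict_space borel (ray b)) \<subseteq> sets M"
  proof
    fix A assume "A \<in> sets (restrict_space borel (ray b))"
    then obtain B where "B \<in> sets borel" "A = ray b \<inter> B"
      by (auto simp: sets_restrict_space)
    then have "A = (\<lambda>x. x) -` B \<inter> space M" by auto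
    then show "A \<in> sets M"
      using measurable_sets[OF measurable_identity \<open>B \<in> sets borel\<close>] by simp
  qed
qed

lemma sets_LS_iff: "A \<in> sets M \<longleftrightarrow> A \<subseteq> ray b \<and> A \<in> sets borel"
  unfolding sets_LS using ray_borel by (simp add: sets_restrict_space_iff)

lemma emeasure_Ico:
  "x \<in> ray b \<Longrightarrow> y \<in> ray b \<Longrightarrow> x \<le> y \<Longrightarrow> emeasure M {x..<y} = ennreal (R y - R x)"
  using b_pos R_mono R_left_cont by (intro LS_emeasure) (auto simp: ray_def)

lemma R_nonneg: "x \<in> ray b \<Longrightarrow> 0 \<le> R x"
  using mono_onD[OF R_mono zero_in_ray[OF b_pos], of x] R_zero by (auto simp: ray_def)

lemma measure_initial: "x \<in> ray b \<Longrightarrow> measure M {0..<x} = R x"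
  using emeasure_Ico[of 0 x] zero_in_ray[OF b_pos] R_nonneg[of x]
  by (auto simp: measure_def R_zero ray_def)

lemma sets_initial [measurable]: "x \<in> ray b \<Longrightarrow> {0..<x} \<in> sets M"
  by (auto simp: sets_LS_iff dest: Ico_subset_ray)

lemma emeasure_initial_finite: "x \<in> ray b \<Longrightarrow> emeasure M {0..<x} < \<infinity>"
  using emeasure_Ico[of 0 x] zero_in_ray[OF b_pos] by (auto simp: ray_def)

lemma sigma_finite: "sigma_finite_measure M"
proof
  obtain c where c: "incseq c" "\<And>n. c n \<in> ray b" "\<And>x. x \<in> ray b \<Longrightarrow> \<exists>n. x < c n"
    using ray_exhaustion[OF b_pos] by blast
  show "\<exists>A. countable A \<and> A \<subseteq> sets M \<and> \<Union>A = space M \<and> (\<forall>a\<in>A. emeasure M a \<noteq> \<infinity>)"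
  proof (intro exI conjI)
    show "countable (range (\<lambda>n. {0..<c n}))" by simp
    show "range (\<lambda>n. {0..<c n}) \<subseteq> sets M" using c(2) by auto
    show "\<Union> (range (\<lambda>n. {0..<c n})) = space M"
    proof
      show "\<Union> (range (\<lambda>n. {0..<c n})) \<subseteq> space M"
        using c(2) Ico_subset_ray by fastforce
      show "space M \<subseteq> \<Union> (range (\<lambda>n. {0..<c n}))"
        using c(3) by (auto simp: ray_def)
    qed
    show "\<forall>a\<in>range (\<lambda>n. {0..<c n}). emeasure M a \<noteq> \<infinity>"
      using c(2) emeasure_initial_finite by (auto simp: less_top)
  qed
qed

text \<open>The intervals \<open>[s,y)\<close> with \<open>y \<down> s\<close> have mass \<open>R y - R s\<close>, so an atom at \<open>s\<close> is a jump of
  \<open>R\<close> to the right of \<open>s\<close>.\<close>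

lemma singleton_null:
  assumes s: "s \<in> ray b" and cont: "continuous (at s within ray b) R"
  shows "{s} \<in> null_sets M"
proof -
  have "emeasure M {s} \<le> ennreal e" if "0 < e" for e
  proof -
    obtain d where d: "0 < d" "\<And>x. x \<in> ray b \<Longrightarrow> dist x s < d \<Longrightarrow> dist (R x) (R s) < e"
      using cont \<open>0 < e\<close> unfolding continuous_within_eps_delta by blast
    obtain y0 where y0: "s < y0" "ereal y0 < b"
      using s ereal_dense2[of "ereal s" b] by (auto simp: ray_def)
    define y where "y = min y0 (s + d / 2)"
    have y: "s < y" "y \<in> ray b" "dist y s < d"
      using y0 d(1) s by (auto simp: y_def ray_def dist_real_def min_def less_imp_le intro: less_trans[of "ereal _" "ereal y0"])
    have "emeasure M {s} \<le> emeasure M {s..<y}"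
      using y s by (intro emeasure_mono) (auto simp: sets_LS_iff ray_def intro: less_trans[of "ereal _" "ereal y"])
    also have "\<dots> = ennreal (R y - R s)"
      using y s by (intro emeasure_Ico) auto
    also have "\<dots> \<le> ennreal e"
      using d(2)[OF y(2,3)] by (intro ennreal_leI) (simp add: dist_real_def)
    finally show ?thesis .
  qed
  then have "emeasure M {s} = 0"
    using ennreal_le_epsilon[of 0 "emeasure M {s}"] by simp
  then show ?thesis
    using s by (auto simp: null_sets_def sets_LS_iff)
qed

end

section \<open>Primitives of locally integrable functions\<close>

definition loc_int :: "ereal \<Rightarrow> real measure \<Rightarrow> (real \<Rightarrow> 'a::{banach, second_countable_topology}) \<Rightarrow> bool" where
  "loc_int b N f \<longleftrightarrow> f \<in> borel_measurable N \<and> (\<forall>x\<in>ray b. set_integrable N {0..<x} f)"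

definition loc_bdd :: "ereal \<Rightarrow> (real \<Rightarrow> 'a::real_normed_vector) \<Rightarrow> bool" where
  "loc_bdd b f \<longleftrightarrow> (\<forall>x\<in>ray b. \<exists>B. \<forall>t\<in>{0..<x}. norm (f t) \<le> B)"

lemma loc_bddD:
  assumes "loc_bdd b f" "x \<in> ray b"
  obtains B where "0 < B" "\<And>t. 0 \<le> t \<Longrightarrow> t < x \<Longrightarrow> norm (f t) \<le> B"
proof -
  obtain B where B: "\<forall>t\<in>{0..<x}. norm (f t) \<le> B"
    using assms by (auto simp: loc_bdd_def)
  then have "norm (f t) \<le> max 1 B" if "0 \<le> t" "t < x" for t
    using that by (auto simp: le_max_iff_disj)
  then show ?thesis by (intro that[of "max 1 B"]) auto
qed

lemma loc_bdd_const [simp]: "loc_bdd b (\<lambda>_. c)"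
  by (auto simp: loc_bdd_def)

lemma loc_bdd_norm [simp]: "loc_bdd b (\<lambda>x. norm (f x)) \<longleftrightarrow> loc_bdd b f"
  by (auto simp: loc_bdd_def)

lemma loc_bdd_add [intro]:
  assumes "loc_bdd b f" "loc_bdd b g"
  shows "loc_bdd b (\<lambda>x. f x + g x)"
  unfolding loc_bdd_def
proof
  fix x assume x: "x \<in> ray b"
  obtain B where B: "\<And>t. 0 \<le> t \<Longrightarrow> t < x \<Longrightarrow> norm (f t) \<le> B"
    using loc_bddD[OF assms(1) x] by blast
  obtain C where C: "\<And>t. 0 \<le> t \<Longrightarrow> t < x \<Longrightarrow> norm (g t) \<le> C"
    using loc_bddD[OF assms(2) x] by blast
  show "\<exists>B. \<forall>t\<in>{0..<x}. norm (f t + g t) \<le> B"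
    using B C by (intro exI[of _ "B + C"]) (auto intro: norm_triangle_mono)
qed

lemma loc_bdd_uminus [simp]: "loc_bdd b (\<lambda>x. - f x) \<longleftrightarrow> loc_bdd b f"
  by (auto simp: loc_bdd_def)

lemma loc_bdd_diff [intro]: "loc_bdd b f \<Longrightarrow> loc_bdd b g \<Longrightarrow> loc_bdd b (\<lambda>x. f x - g x)"
  using loc_bdd_add[of b f "\<lambda>x. - g x"] by simp

lemma loc_bdd_mult [intro]:
  fixes f g :: "real \<Rightarrow> 'a::real_normed_field"
  assumes "loc_bdd b f" "loc_bdd b g"
  shows "loc_bdd b (\<lambda>x. f x * g x)"
  unfolding loc_bdd_def
proof
  fix x assume x: "x \<in> ray b"
  obtain B where B: "0 < B" "\<And>t. 0 \<le> t \<Longrightarrow> t < x \<Longrightarrow> norm (f t) \<le> B"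
    using loc_bddD[OF assms(1) x] by blast
  obtain C where C: "\<And>t. 0 \<le> t \<Longrightarrow> t < x \<Longrightarrow> norm (g t) \<le> C"
    using loc_bddD[OF assms(2) x] by blast
  show "\<exists>B. \<forall>t\<in>{0..<x}. norm (f t * g t) \<le> B"
    using B C by (intro exI[of _ "B * C"]) (auto simp: norm_mult intro!: mult_mono)
qed

lemma loc_bdd_cong: "(\<And>x. x \<in> ray b \<Longrightarrow> f x = g x) \<Longrightarrow> loc_bdd b f \<longleftrightarrow> loc_bdd b g"
  unfolding loc_bdd_def by (intro ball_cong refl ex_cong1) (auto dest: ray_downward)

lemma loc_int_measurable: "loc_int b N f \<Longrightarrow> f \<in> borel_measurable N"
  by (simp add: loc_int_def)

lemma loc_intD: "loc_int b N f \<Longrightarrow> x \<in> ray b \<Longrightarrow> set_integrable N {0..<x} f"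
  by (simp add: loc_int_def)

lemma loc_int_add [intro]: "loc_int b N f \<Longrightarrow> loc_int b N g \<Longrightarrow> loc_int b N (\<lambda>x. f x + g x)"
  unfolding loc_int_def by (auto intro!: set_integral_add)

lemma loc_int_norm [intro]: "loc_int b N f \<Longrightarrow> loc_int b N (\<lambda>x. norm (f x))"
  unfolding loc_int_def by (auto intro!: set_integrable_norm)

lemma loc_int_cmult [intro]:
  fixes f :: "real \<Rightarrow> 'a::{real_normed_field, banach, second_countable_topology}"
  shows "loc_int b N f \<Longrightarrow> loc_int b N (\<lambda>x. c * f x)"
  unfolding loc_int_def by auto

lemma loc_int_cnj [intro]: "loc_int b N f \<Longrightarrow> loc_int b N (\<lambda>x. cnj (f x))"
proof -
  assume f: "loc_int b N f"
  have "(\<lambda>x. cnj (f x)) \<in> borel_measurable N"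
    using loc_int_measurable[OF f]
    by (rule borel_measurable_continuous_on[rotated]) (intro continuous_intros)
  then show "loc_int b N (\<lambda>x. cnj (f x))"
    using f unfolding loc_int_def set_integrable_def by (simp flip: complex_cnj_scaleR)
qed

lemma initial_integral_cnj: "(LINT t:A|N. cnj (f t)) = cnj (LINT t:A|N. f t)"
  unfolding set_lebesgue_integral_def by (simp flip: complex_cnj_scaleR)

context stieltjes
begin

lemma loc_int_mult:
  fixes f g :: "real \<Rightarrow> 'a::{real_normed_field, banach, second_countable_topology}"
  assumes "g \<in> borel_measurable M" "loc_bdd b g" "loc_int b M f"
  shows "loc_int b M (\<lambda>x. g x * f x)"
  unfolding loc_int_def
proof (intro conjI ballI)
  have f [measurable]: "f \<in> borel_measurable M"
    using assms(3) by (rule loc_int_measurable)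
  note assms(1) [measurable]
  show "(\<lambda>x. g x * f x) \<in> borel_measurable M" by measurable
  fix x assume x: "x \<in> ray b"
  obtain B where B: "0 < B" "\<And>t. 0 \<le> t \<Longrightarrow> t < x \<Longrightarrow> norm (g t) \<le> B"
    using loc_bddD[OF assms(2) x] by blast
  have "set_integrable M {0..<x} (\<lambda>t. of_real B * f t)"
    using loc_intD[OF assms(3) x] by simp
  then show "set_integrable M {0..<x} (\<lambda>t. g t * f t)"
  proof (rule set_integrable_bound)
    show "set_borel_measurable M {0..<x} (\<lambda>t. g t * f t)"
      unfolding set_borel_measurable_def using x by measurable
    show "AE t in M. t \<in> {0..<x} \<longrightarrow> norm (g t * f t) \<le> norm (of_real B * f t)"
      using B by (auto simp: norm_mult intro!: mult_right_mono)
  qed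
qed

lemma loc_int_const: "loc_int b M (\<lambda>_. c)"
  unfolding loc_int_def set_integrable_def using emeasure_initial_finite
  by (auto intro!: integrableI_bounded_set_indicator[where B="norm c"])

lemma loc_int_bounded:
  fixes f :: "real \<Rightarrow> 'a::{real_normed_field, banach, second_countable_topology}"
  shows "f \<in> borel_measurable M \<Longrightarrow> loc_bdd b f \<Longrightarrow> loc_int b M f"
  using loc_int_mult[OF _ _ loc_int_const[of 1], of f] by simp

lemma integrable_loc_int: "integrable M f \<Longrightarrow> loc_int b M f"
  unfolding loc_int_def set_integrable_def by (auto intro!: integrable_mult_indicator)

text \<open>The primitive is measurable for any measure on the Borel sets of the ray; it is needed for
  \<open>dR\<^sub>1\<close> when the primitive is taken with respect to \<open>dR\<^sub>2\<close>, and vice versa.\<close>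

lemma primitive_measurable:
  fixes f :: "real \<Rightarrow> 'a::{banach, second_countable_topology}"
  assumes f [measurable]: "f \<in> borel_measurable M"
    and N: "sets N = sets (restrict_space borel (ray b))"
  shows "(\<lambda>x. LINT t:{0..<x}|M. f t) \<in> borel_measurable N"
proof -
  interpret sigma_finite_measure M by (rule sigma_finite)
  have [measurable_cong]: "sets N = sets M" using N sets_LS by simp
  note measurable_identity [measurable]
  have [measurable]: "(\<lambda>x. x) \<in> borel_measurable N"
    using measurable_identity measurable_cong_sets[OF \<open>sets N = sets M\<close> refl] by blast
  have "(\<lambda>x. \<integral>t. (if 0 \<le> t \<and> t < x then f t else 0) \<partial>M) \<in> borel_measurable N"
    by (rule borel_measurable_lebesgue_integral) measurable
  also have "(\<lambda>x. \<integral>t. (if 0 \<le> t \<and> t < x then f t else 0) \<partial>M) = (\<lambda>x. LINT t:{0..<x}|M. f t)"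
    unfolding set_lebesgue_integral_def
    by (auto intro!: ext Bochner_Integration.integral_cong split: split_indicator)
  finally show ?thesis .
qed

lemma primitive_mono:
  fixes f :: "real \<Rightarrow> real"
  assumes "loc_int b M f" "\<And>t. t \<in> ray b \<Longrightarrow> 0 \<le> f t" "y \<in> ray b" "0 \<le> x" "x \<le> y"
  shows "(LINT t:{0..<x}|M. f t) \<le> (LINT t:{0..<y}|M. f t)"
proof -
  have "x \<in> ray b" using assms(3-5) by (rule ray_downward)
  then show ?thesis
    using loc_intD[OF assms(1)] assms(2,3,5) ray_downward[of y b]
    unfolding set_integrable_def set_lebesgue_integral_def
    by (intro integral_mono) (auto split: split_indicator)
qed

lemma primitive_nonneg:
  fixes f :: "real \<Rightarrow> real"
  assumes "\<And>t. t \<in> ray b \<Longrightarrow> 0 \<le> f t"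
  shows "0 \<le> (LINT t:{0..<x}|M. f t)"
  unfolding set_lebesgue_integral_def using assms
  by (intro Bochner_Integration.integral_nonneg) (auto split: split_indicator)

lemma primitive_norm_le:
  "loc_int b M f \<Longrightarrow> x \<in> ray b \<Longrightarrow> norm (LINT t:{0..<x}|M. f t) \<le> (LINT t:{0..<x}|M. norm (f t))"
  by (rule set_integral_norm_bound[OF loc_intD])

lemma primitive_bdd:
  assumes "loc_int b M f"
  shows "loc_bdd b (\<lambda>x. LINT t:{0..<x}|M. f t)"
  unfolding loc_bdd_def
proof
  fix x assume x: "x \<in> ray b"
  have "norm (LINT t:{0..<y}|M. f t) \<le> (LINT t:{0..<x}|M. norm (f t))" if y: "y \<in> {0..<x}" for y
  proof -
    have "y \<in> ray b" using x y by (auto intro: ray_downward)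
    then have "norm (LINT t:{0..<y}|M. f t) \<le> (LINT t:{0..<y}|M. norm (f t))"
      by (rule primitive_norm_le[OF assms])
    also have "\<dots> \<le> (LINT t:{0..<x}|M. norm (f t))"
      using x y assms by (intro primitive_mono) auto
    finally show ?thesis .
  qed
  then show "\<exists>B. \<forall>y\<in>{0..<x}. norm (LINT t:{0..<y}|M. f t) \<le> B" by blast
qed

lemma primitive_split:
  assumes "loc_int b M f" "y \<in> ray b" "0 \<le> x" "x \<le> y"
  shows "(LINT t:{0..<y}|M. f t) = (LINT t:{0..<x}|M. f t) + (LINT t:{x..<y}|M. f t)"
proof -
  have i: "set_integrable M {0..<y} f" using assms(1,2) by (rule loc_intD)
  have "{0..<y} = {0..<x} \<union> {x..<y}" using assms(3,4) by auto
  moreover have "(LINT t:{0..<x} \<union> {x..<y}|M. f t) = (LINT t:{0..<x}|M. f t) + (LINT t:{x..<y}|M. f t)"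
  proof (rule set_integral_Un)
    show "set_integrable M {0..<x} f"
      using assms(1) ray_downward[OF assms(2-4)] by (rule loc_intD)
    have "{x..<y} \<in> sets M"
      using assms by (intro sets_LS_Ico) (auto simp: ray_def)
    then show "set_integrable M {x..<y} f"
      by (rule set_integrable_subset[OF i]) (use assms(3) in auto)
  qed auto
  ultimately show ?thesis by simp
qed

lemma UN_initial:
  assumes "\<And>n::nat. c n \<in> ray b" "\<And>x. x \<in> ray b \<Longrightarrow> \<exists>n. x < c n"
  shows "(\<Union>n. {0..<c n}) = ray b"
  using assms(1) Ico_subset_ray[of _ 0] assms(2) by (fastforce simp: ray_def)

lemma primitive_tendsto:
  fixes f :: "real \<Rightarrow> 'a::{banach, second_countable_topology}"
  assumes f: "integrable M f"
  shows "((\<lambda>x. LINT t:{0..<x}|M. f t) \<longlongrightarrow> (LINT t|M. f t)) (at_end b)"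
proof (rule tendstoI)
  fix e :: real assume "0 < e"
  obtain c where c: "incseq c" "\<And>n. c n \<in> ray b" "\<And>x. x \<in> ray b \<Longrightarrow> \<exists>n. x < c n"
    using ray_exhaustion[OF b_pos] by blast
  have fn: "integrable M (\<lambda>t. norm (f t))" using f by simp
  have "(\<lambda>n. LINT t:{0..<c n}|M. norm (f t)) \<longlonglongrightarrow> (LINT t:(\<Union>n. {0..<c n})|M. norm (f t))"
    using c(1,2) fn integrable_mult_indicator[OF sets.top fn]
    by (intro set_integral_cont_up)
       (auto simp: incseq_def set_integrable_def UN_initial[OF c(2,3)] intro: order.strict_trans2)
  also have "(LINT t:(\<Union>n. {0..<c n})|M. norm (f t)) = (LINT t|M. norm (f t))"
    using UN_initial[OF c(2,3)] set_integral_space[OF fn] by (simp only: space_LS)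
  finally obtain n where n: "dist (LINT t:{0..<c n}|M. norm (f t)) (LINT t|M. norm (f t)) < e"
    using \<open>0 < e\<close> by (meson LIMSEQ_iff_nz lim_sequentially order_refl)
  have "dist (LINT t:{0..<x}|M. f t) (LINT t|M. f t) < e" if x: "x \<in> ray b" "c n \<le> x" for x
  proof -
    have i: "integrable M (\<lambda>t. indicator {0..<x} t *\<^sub>R f t)"
      using x f by (intro integrable_mult_indicator) auto
    have ic: "integrable M (\<lambda>t. indicator {0..<c n} t *\<^sub>R norm (f t))"
      using c(2) fn by (intro integrable_mult_indicator) auto
    have "dist (LINT t:{0..<x}|M. f t) (LINT t|M. f t)
        = norm (LINT t|M. f t - indicator {0..<x} t *\<^sub>R f t)"
      unfolding set_lebesgue_integral_def dist_norm using i f by (simp add: norm_minus_commute)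
    also have "\<dots> \<le> (LINT t|M. norm (f t - indicator {0..<x} t *\<^sub>R f t))"
      by (rule integral_norm_bound)
    also have "\<dots> \<le> (LINT t|M. norm (f t) - indicator {0..<c n} t *\<^sub>R norm (f t))"
      using x i ic f by (intro integral_mono) (auto split: split_indicator)
    also have "\<dots> = (LINT t|M. norm (f t)) - (LINT t:{0..<c n}|M. norm (f t))"
      unfolding set_lebesgue_integral_def using ic fn by simp
    also have "\<dots> < e" using n by (simp add: dist_real_def)
    finally show ?thesis .
  qed
  then show "\<forall>\<^sub>F x in at_end b. dist (LINT t:{0..<x}|M. f t) (LINT t|M. f t) < e"
    using c(2) by (auto simp: eventually_at_end[OF b_pos])
qed

lemma integrable_if_primitive_bounded:
  fixes f :: "real \<Rightarrow> real"
  assumes f: "loc_int b M f" and nn: "\<And>t. t \<in> ray b \<Longrightarrow> 0 \<le> f t"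
    and B: "\<And>x. x \<in> ray b \<Longrightarrow> (LINT t:{0..<x}|M. f t) \<le> B"
  shows "integrable M f"
proof -
  obtain c where c: "incseq c" "\<And>n. c n \<in> ray b" "\<And>x. x \<in> ray b \<Longrightarrow> \<exists>n. x < c n"
    using ray_exhaustion[OF b_pos] by blast
  have "incseq (\<lambda>n. LINT t:{0..<c n}|M. f t)"
    unfolding incseq_def using c(1,2) f nn
    by (auto intro!: primitive_mono simp: incseq_def) (auto simp: ray_def)
  then obtain l where l: "(\<lambda>n. LINT t:{0..<c n}|M. f t) \<longlonglongrightarrow> l"
    using incseq_convergent[of _ B] B[OF c(2)] by blast
  have "set_integrable M (\<Union>n. {0..<c n}) f"
  proof (rule pos_integrable_to_top[where l=l])
    show "mono (\<lambda>n. {0..<c n})"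
      using c(1) by (auto simp: mono_def incseq_def intro: order.strict_trans2)
    show "0 \<le> f t" if "t \<in> {0..<c n}" for t n
      using that Ico_subset_ray[OF c(2), of 0 n] nn by blast
  qed (use c(2) l loc_intD[OF f c(2)] in auto)
  then have "integrable M (\<lambda>t. indicator (ray b) t *\<^sub>R f t)"
    by (simp add: UN_initial[OF c(2,3)] set_integrable_def)
  then show ?thesis
    by (rule Bochner_Integration.integrable_cong[THEN iffD1, rotated -1]) auto
qed

section \<open>Gronwall inequalities\<close>

text \<open>Let \<open>G\<close> be the primitive of \<open>h\<close> and \<open>c\<close> the infimum of \<open>{G > 0}\<close>. Then \<open>h\<close> vanishes on \<open>[0,c]\<close>, because \<open>G(c)\<close> does
  not see the point \<open>c\<close>. Consequently \<open>G(x) \<le> K G(x) \<mu>(c,x)\<close> for \<open>x > c\<close>, which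
  forces \<open>G(x) = 0\<close> as soon as \<open>K \<mu>(c,x) < 1\<close>. An atom at \<open>c\<close> is harmless.\<close>

lemma gronwall_zero:
  fixes h :: "real \<Rightarrow> real"
  assumes h: "loc_int b M h" and nn: "\<And>t. t \<in> ray b \<Longrightarrow> 0 \<le> h t" and X: "X \<in> ray b"
    and le: "\<And>x. 0 \<le> x \<Longrightarrow> x \<le> X \<Longrightarrow> h x \<le> K * (LINT t:{0..<x}|M. h t)"
  shows "h X = 0"
proof (rule ccontr)
  define G where "G x = (LINT t:{0..<x}|M. h t)" for x
  have ray: "x \<in> ray b" if "0 \<le> x" "x \<le> X" for x using X that by (rule ray_downward)
  have G_nonneg: "0 \<le> G x" for x unfolding G_def using nn by (rule primitive_nonneg)
  have G_mono: "G x \<le> G y" if "0 \<le> x" "x \<le> y" "y \<le> X" for x y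
    unfolding G_def using that nn ray[of y] by (intro primitive_mono[OF h]) auto
  have h0: "h x = 0" if "0 \<le> x" "x \<le> X" "G x = 0" for x
    using le[OF that(1,2)] nn[OF ray[OF that(1,2)]] that(3) by (simp add: G_def)
  assume "h X \<noteq> 0"
  then have GX: "G X > 0"
    using h0[of X] X G_nonneg[of X] by (auto simp: ray_def less_le)
  \<comment> \<open>A negative \<open>K\<close> would make \<open>h X\<close> negative.\<close>
  have K: "0 \<le> K"
  proof (rule ccontr)
    assume "\<not> 0 \<le> K"
    then have "h X < 0"
      using le[of X] X mult_neg_pos[of K "G X"] GX unfolding G_def[symmetric] by (simp add: ray_def)
    then show False using nn[OF X] by simp
  qed
  define S where "S = {x. 0 \<le> x \<and> x \<le> X \<and> G x > 0}"
  have S: "X \<in> S" "bdd_below S"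
    using GX X unfolding S_def bdd_below_def by (auto simp: ray_def)
  define c where "c = Inf S"
  have c: "0 \<le> c" "c \<le> X"
    unfolding c_def using S by (auto simp: S_def intro!: cInf_greatest cInf_lower)
  have G_below: "G x = 0" if "0 \<le> x" "x < c" for x
  proof -
    have "x \<notin> S" using that(2) S(2) cInf_lower[of x S] unfolding c_def by linarith
    then show ?thesis using that c(2) G_nonneg[of x] unfolding S_def by force
  qed
  have "G c = 0"
    unfolding G_def set_lebesgue_integral_def
  proof (intro integral_eq_zero_AE AE_I2)
    fix t assume "t \<in> space M"
    then have "0 \<le> t" by (simp add: ray_def)
    then show "indicator {0..<c} t *\<^sub>R h t = 0"
      using G_below[of t] h0[of t] c(2) by (cases "t < c") auto
  qed
  then have "c < X" using GX c by (cases "c = X") auto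
  have h_le_c: "h x = 0" if "0 \<le> x" "x \<le> c" for x
  proof -
    have "G x = 0" using that G_below[of x] \<open>G c = 0\<close> by (cases "x = c") auto
    then show ?thesis using that c(2) by (intro h0) auto
  qed
  define d where "d n = c + (X - c) / real (Suc n)" for n
  have d_dec: "d n \<le> d m" if "m \<le> n" for m n
    using \<open>c < X\<close> that by (auto simp: d_def intro!: divide_left_mono)
  have d: "c < d n" "d n \<le> X" for n
    using \<open>c < X\<close> d_dec[of 0 n] by (simp_all add: d_def)
  have d_ray: "d n \<in> ray b" for n using d[of n] c by (intro ray) linarith+
  have d_lim: "d \<longlonglongrightarrow> c"
  proof -
    have "(\<lambda>n. c + (X - c) * inverse (real (Suc n))) \<longlonglongrightarrow> c + (X - c) * 0"
      by (intro tendsto_intros LIMSEQ_inverse_real_of_nat)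
    then show ?thesis by (simp add: d_def[abs_def] divide_inverse)
  qed
  have Ioo_sets: "{c<..<d n} \<in> sets M" for n
    using c Ico_subset_ray[OF d_ray[of n], of 0] by (auto simp: sets_LS_iff)
  have Ioo_fin: "emeasure M {c<..<d n} \<noteq> \<infinity>" for n
  proof -
    have "emeasure M {c<..<d n} \<le> emeasure M {0..<d n}"
      using c d_ray by (intro emeasure_mono) auto
    then show ?thesis using emeasure_initial_finite[OF d_ray[of n]] by (auto simp: top_unique)
  qed
  have "(\<lambda>n. measure M {c<..<d n}) \<longlonglongrightarrow> measure M (\<Inter>n. {c<..<d n})"
  proof (rule Lim_measure_decseq)
    show "decseq (\<lambda>n. {c<..<d n})"
      unfolding decseq_def using d_dec by (intro allI impI greaterThanLessThan_subseteq_greaterThanLessThan[THEN iffD2]) auto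
  qed (use Ioo_sets Ioo_fin in auto)
  also have "(\<Inter>n. {c<..<d n}) = {}"
  proof -
    have "False" if x: "\<forall>n. c < x \<and> x < d n" for x
    proof -
      have "\<forall>n\<ge>0. x \<le> d n" using x less_imp_le by blast
      then have "x \<le> c" by (intro LIMSEQ_le_const[OF d_lim]) blast
      then show False using x by auto
    qed
    then show ?thesis by fastforce
  qed
  finally have "(\<lambda>n. K * measure M {c<..<d n}) \<longlonglongrightarrow> K * 0"
    by (intro tendsto_intros) simp
  then obtain n where n: "K * measure M {c<..<d n} < 1"
    using order_tendstoD(2)[of _ "K * 0" sequentially 1] by (auto simp: eventually_sequentially)
  obtain x where x: "x \<in> S" "x < d n"
    using cInf_lessD[of S "d n"] S(1) d(1)[of n] unfolding c_def by blast
  have Gx: "0 \<le> x" "x \<le> X" "0 < G x" using x by (auto simp: S_def)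
  have "G x \<le> (LINT t:{c<..<d n}|M. K * G x)"
  proof -
    have "G x = (LINT t|M. indicator {0..<x} t *\<^sub>R h t)"
      by (simp add: G_def set_lebesgue_integral_def)
    also have "\<dots> \<le> (LINT t|M. indicator {c<..<d n} t *\<^sub>R (K * G x))"
    proof (rule integral_mono)
      show "integrable M (\<lambda>t. indicator {0..<x} t *\<^sub>R h t)"
        using loc_intD[OF h ray[OF Gx(1,2)]] by (simp add: set_integrable_def)
      show "integrable M (\<lambda>t. indicator {c<..<d n} t *\<^sub>R (K * G x))"
        using Ioo_sets Ioo_fin[of n] by (intro integrable_scaleR_left) (auto simp: less_top)
      fix t assume t: "t \<in> space M"
      consider "t < x" "c < t" | "x \<le> t" | "t \<le> c" by force
      then show "indicator {0..<x} t *\<^sub>R h t \<le> indicator {c<..<d n} t *\<^sub>R (K * G x)"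
      proof cases
        case 1
        have "h t \<le> K * G t" using t 1 Gx le[of t] by (auto simp: G_def ray_def)
        also have "\<dots> \<le> K * G x" using t 1 Gx K by (intro mult_left_mono G_mono) (auto simp: ray_def)
        finally show ?thesis using 1 x(2) t by (auto simp: ray_def)
      qed (use t K Gx(3) h_le_c[of t] in \<open>auto simp: ray_def split: split_indicator\<close>)
    qed
    finally show ?thesis by (simp only: set_lebesgue_integral_def)
  qed
  also have "\<dots> = measure M {c<..<d n} * (K * G x)"
    using Ioo_sets Ioo_fin by (subst set_integral_const) auto
  also have "\<dots> < G x"
    using mult_strict_right_mono[OF n Gx(3)] by (simp add: ac_simps)
  finally show False by simp
qed

text \<open>Choose \<open>a\<close> with \<open>\<integral> g\<^sup>2 \<le> 1/2\<close> over \<open>[a,b)\<close> and let \<open>J\<close> be the primitive of \<open>h g\<close>. Then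
  \<open>J(x) - J(a) \<le> (1 + J(x)) / 2\<close> for \<open>x \<ge> a\<close>, so \<open>J\<close> is bounded and \<open>h\<close> is at most a
  multiple of \<open>g\<close>.\<close>

lemma gronwall_square_integrable:
  fixes h g :: "real \<Rightarrow> real"
  assumes h: "loc_int b M h" and hb: "loc_bdd b h" and hnn: "\<And>t. t \<in> ray b \<Longrightarrow> 0 \<le> h t"
    and g: "g \<in> borel_measurable M" "loc_bdd b g" "\<And>t. t \<in> ray b \<Longrightarrow> 0 \<le> g t"
    and g2: "integrable M (\<lambda>t. (g t)\<^sup>2)"
    and le: "\<And>x. x \<in> ray b \<Longrightarrow> h x \<le> g x * (1 + (LINT t:{0..<x}|M. h t * g t))"
  shows "integrable M (\<lambda>t. (h t)\<^sup>2)"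
proof -
  define J where "J x = (LINT t:{0..<x}|M. h t * g t)" for x
  have [measurable]: "h \<in> borel_measurable M" "g \<in> borel_measurable M"
    using h g(1) by (auto simp: loc_int_def)
  have hg: "loc_int b M (\<lambda>t. h t * g t)"
    using hb g h by (intro loc_int_bounded) (auto simp: loc_int_def)
  have hgnn: "0 \<le> h t * g t" if "t \<in> ray b" for t using hnn g(3) that by auto
  have Jnn: "0 \<le> J x" for x unfolding J_def using hgnn by (rule primitive_nonneg)
  have Jmono: "J x \<le> J y" if "0 \<le> x" "x \<le> y" "y \<in> ray b" for x y
    unfolding J_def using that by (intro primitive_mono[OF hg hgnn]) auto
  have "((\<lambda>x. LINT t:{0..<x}|M. (g t)\<^sup>2) \<longlongrightarrow> (LINT t|M. (g t)\<^sup>2)) (at_end b)"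
    using g2 by (rule primitive_tendsto)
  \<comment> \<open>Two values of the primitive within 1/4 of its limit differ by less than 1/2.\<close>
  then have "\<forall>\<^sub>F x in at_end b. dist (LINT t:{0..<x}|M. (g t)\<^sup>2) (LINT t|M. (g t)\<^sup>2) < 1/4"
    by (rule tendstoD) simp
  then obtain a where a: "a \<in> ray b"
    "\<And>x. x \<in> ray b \<Longrightarrow> a \<le> x \<Longrightarrow> dist (LINT t:{0..<x}|M. (g t)\<^sup>2) (LINT t|M. (g t)\<^sup>2) < 1/4"
    using eventually_at_end[OF b_pos] by auto
  have a0: "0 \<le> a" using a(1) by (auto simp: ray_def)
  have J_bound: "J x \<le> 1 + 2 * J a" if x: "x \<in> ray b" "a \<le> x" for x
  proof -
    have g2i: "loc_int b M (\<lambda>t. (g t)\<^sup>2)" using g2 by (rule integrable_loc_int)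
    have axm: "{a..<x} \<in> sets M" using x a0 Ico_subset_ray[of x a] by (auto simp: sets_LS_iff)
    have int_sub: "set_integrable M {a..<x} f" if "loc_int b M f" for f :: "real \<Rightarrow> real"
      using a0 by (intro set_integrable_subset[OF loc_intD[OF that x(1)] axm]) auto
    have "(LINT t:{a..<x}|M. (g t)\<^sup>2) \<le> 1/2"
      using a(2)[OF x] a(2)[OF a(1) order_refl] primitive_split[OF g2i x(1) a0 x(2)]
      by (simp only: dist_real_def abs_less_iff) linarith
    then have half: "(LINT t:{a..<x}|M. (g t)\<^sup>2) * (1 + J x) \<le> 1/2 * (1 + J x)"
      using Jnn[of x] by (intro mult_right_mono) auto
    have "J x - J a = (LINT t:{a..<x}|M. h t * g t)"
      using primitive_split[OF hg x(1) a0 x(2)] by (simp add: J_def)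
    also have "\<dots> \<le> (LINT t:{a..<x}|M. (g t)\<^sup>2 * (1 + J x))"
    proof (rule set_integral_mono)
      fix t assume t: "t \<in> {a..<x}"
      then have tr: "t \<in> ray b" "0 \<le> t" using x a0 ray_downward[of x b t] by auto
      have "h t \<le> g t * (1 + J t)" using le[OF tr(1)] by (simp add: J_def)
      also have "\<dots> \<le> g t * (1 + J x)"
        using t tr x g(3) by (intro mult_left_mono add_left_mono Jmono) auto
      finally have "h t * g t \<le> g t * (1 + J x) * g t"
        using g(3)[OF tr(1)] by (rule mult_right_mono)
      then show "h t * g t \<le> (g t)\<^sup>2 * (1 + J x)"
        by (simp add: power2_eq_square ac_simps)
    qed (use int_sub[OF hg] int_sub[OF g2i] in auto)
    also have "\<dots> = (LINT t:{a..<x}|M. (g t)\<^sup>2) * (1 + J x)" by simp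
    finally have "J x - J a \<le> 1/2 * (1 + J x)" using half by simp
    then show ?thesis by (simp add: field_simps)
  qed
  define A where "A = 2 + 2 * J a"
  have A: "0 \<le> A" using Jnn[of a] by (simp add: A_def)
  have h_le: "h x \<le> g x * A" if x: "x \<in> ray b" for x
  proof -
    have "J x \<le> 1 + 2 * J a"
    proof (cases "a \<le> x")
      case False
      then have "J x \<le> J a" using x a(1) by (intro Jmono) (auto simp: ray_def)
      then show ?thesis using Jnn[of a] by simp
    qed (use J_bound x in auto)
    then have "g x * (1 + J x) \<le> g x * A"
      using g(3)[OF x] by (intro mult_left_mono) (auto simp: A_def)
    then show ?thesis using le[OF x] by (simp add: J_def)
  qed
  have "integrable M (\<lambda>t. (g t)\<^sup>2 * A\<^sup>2)" using g2 by simp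
  then show ?thesis
  proof (rule Bochner_Integration.integrable_bound)
    show "AE t in M. norm ((h t)\<^sup>2) \<le> norm ((g t)\<^sup>2 * A\<^sup>2)"
    proof (rule AE_I2)
      fix t assume "t \<in> space M"
      then have "(h t)\<^sup>2 \<le> (g t * A)\<^sup>2" using h_le hnn by (intro power_mono) auto
      then show "norm ((h t)\<^sup>2) \<le> norm ((g t)\<^sup>2 * A\<^sup>2)" by (simp add: power_mult_distrib)
    qed
  qed measurable
qed

end

section \<open>Integration by parts and the Lagrange identity\<close>

locale stieltjes_pair = S1: stieltjes b R1 + S2: stieltjes b R2
  for b :: ereal and R1 R2 :: "real \<Rightarrow> real" +
  assumes no_common_jump:
    "\<And>x. x \<in> ray b \<Longrightarrow> continuous (at x within ray b) R1 \<or> continuous (at x within ray b) R2"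
begin

abbreviation M1 :: "real measure" where "M1 \<equiv> S1.M"
abbreviation M2 :: "real measure" where "M2 \<equiv> S2.M"

lemmas b_pos = S1.b_pos

text \<open>An atom of \<open>dR\<^sub>1\<close> is a discontinuity of \<open>R\<^sub>1\<close>. There are countably many of these by monotonicity, and each is a
  continuity point of \<open>R\<^sub>2\<close>, hence a null set of \<open>dR\<^sub>2\<close>.\<close>

lemma AE_M2_no_atom: "AE s in M2. emeasure M1 {s} = 0"
proof -
  define D where "D = {s \<in> ray b. \<not> continuous (at s within ray b) R1}"
  have "countable D"
    unfolding D_def by (rule mono_on_ctble_discont[OF S1.R_mono])
  moreover have "{s} \<in> null_sets M2" if "s \<in> D" for s
    using that no_common_jump[of s] by (intro S2.singleton_null) (auto simp: D_def)
  ultimately have "(\<Union>s\<in>D. {s}) \<in> null_sets M2"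
    by (rule null_sets_UN')
  then have "AE s in M2. s \<notin> D"
    by (auto dest: AE_not_in)
  then show ?thesis
    using AE_space
  proof eventually_elim
    case (elim s)
    then show ?case using S1.singleton_null[of s] by (auto simp: D_def null_sets_def)
  qed
qed

lemma AE_M2_closed_initial:
  fixes a :: "real \<Rightarrow> 'a::{banach, second_countable_topology}"
  assumes a: "loc_int b M1 a"
  shows "AE s in M2. (LINT t:{0..s}|M1. a t) = (LINT t:{0..<s}|M1. a t)"
  using AE_M2_no_atom AE_space
proof eventually_elim
  case (elim s)
  then have s: "s \<in> ray b" "0 \<le> s" by (auto simp: ray_def)
  have [measurable]: "{s} \<in> sets M1" "{0..<s} \<in> sets M1" "{0..s} \<in> sets M1"
    using s S1.Ico_subset_ray[of s 0] by (auto simp: S1.sets_LS_iff intro: ray_downward[of s])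
  note [measurable] = loc_int_measurable[OF a]
  have "AE t in M1. t \<noteq> s"
    using elim(1) by (intro AE_I[where N="{s}"]) auto
  then show ?case
    unfolding set_lebesgue_integral_def
    by (intro integral_cong_AE) (auto split: split_indicator)
qed

text \<open>The product of the integrals is a double integral over a square, which is split into the parts
  \<open>s < t\<close> and \<open>t \<le> s\<close>. The inner integral of the second part extends over the closed interval
  \<open>[0,s]\<close>; replacing it by \<open>[0,s)\<close> changes it only for \<open>s\<close> in a \<open>dR\<^sub>2\<close>-null set, which
  is where the absence of common jumps enters.\<close>

lemma integration_by_parts:
  fixes a c :: "real \<Rightarrow> complex"
  assumes a: "loc_int b M1 a" and c: "loc_int b M2 c" and x: "x \<in> ray b"
  shows "(LINT t:{0..<x}|M1. a t) * (LINT s:{0..<x}|M2. c s)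
    = (LINT t:{0..<x}|M1. a t * (LINT s:{0..<t}|M2. c s))
    + (LINT s:{0..<x}|M2. (LINT t:{0..<s}|M1. a t) * c s)"
proof -
  interpret F: pair_sigma_finite M1 M2
    by (intro pair_sigma_finite.intro S1.sigma_finite S2.sigma_finite)
  note [measurable] = loc_int_measurable[OF a] loc_int_measurable[OF c]
    S1.measurable_identity S2.measurable_identity
  have x1: "{0..<x} \<in> sets M1" and x2: "{0..<x} \<in> sets M2"
    using x by (rule S1.sets_initial, intro S2.sets_initial)
  note [measurable] = x1 x2
  define a' where "a' t = indicator {0..<x} t *\<^sub>R a t" for t
  define c' where "c' s = indicator {0..<x} s *\<^sub>R c s" for s
  have [measurable]: "a' \<in> borel_measurable M1" "c' \<in> borel_measurable M2"
    unfolding a'_def[abs_def] c'_def[abs_def] by measurable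
  have a': "integrable M1 a'" and c': "integrable M2 c'"
    using loc_intD[OF a x] loc_intD[OF c x]
    by (simp_all add: set_integrable_def a'_def[abs_def] c'_def[abs_def])
  define below where "below t s = (if s < t then a' t * c' s else 0)" for t s :: real
  define above where "above t s = (if s < t then 0 else a' t * c' s)" for t s :: real
  have full: "integrable (M1 \<Otimes>\<^sub>M M2) (\<lambda>(t, s). a' t * c' s)"
  proof (rule F.Fubini_integrable)
    show "(\<lambda>(t, s). a' t * c' s) \<in> borel_measurable (M1 \<Otimes>\<^sub>M M2)" by measurable
    show "AE t in M1. integrable M2 (\<lambda>s. case (t, s) of (t, s) \<Rightarrow> a' t * c' s)"
      using c' by simp
    show "integrable M1 (\<lambda>t. LINT s|M2. norm (case (t, s) of (t, s) \<Rightarrow> a' t * c' s))"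
      using a' by (simp add: norm_mult)
  qed
  have [measurable]: "fst \<in> borel_measurable (M1 \<Otimes>\<^sub>M M2)" "snd \<in> borel_measurable (M1 \<Otimes>\<^sub>M M2)"
    using measurable_compose[OF measurable_fst S1.measurable_identity]
      measurable_compose[OF measurable_snd S2.measurable_identity] by auto
  have "(\<lambda>p. if snd p < fst p then a' (fst p) * c' (snd p) else 0) \<in> borel_measurable (M1 \<Otimes>\<^sub>M M2)"
    by measurable
  then have below_meas: "case_prod below \<in> borel_measurable (M1 \<Otimes>\<^sub>M M2)"
    by (simp add: below_def split_beta')
  have "(\<lambda>p. if snd p < fst p then 0 else a' (fst p) * c' (snd p)) \<in> borel_measurable (M1 \<Otimes>\<^sub>M M2)"
    by measurable
  then have above_meas: "case_prod above \<in> borel_measurable (M1 \<Otimes>\<^sub>M M2)"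
    by (simp add: above_def split_beta')
  have below_int: "integrable (M1 \<Otimes>\<^sub>M M2) (case_prod below)"
    by (rule Bochner_Integration.integrable_bound[OF full])
       (use below_meas in \<open>auto simp: below_def\<close>)
  have above_int: "integrable (M1 \<Otimes>\<^sub>M M2) (case_prod above)"
    by (rule Bochner_Integration.integrable_bound[OF full])
       (use above_meas in \<open>auto simp: above_def\<close>)
  have "(LINT t|M1. a' t) * (LINT s|M2. c' s) = (LINT t|M1. LINT s|M2. a' t * c' s)"
    by simp
  also have "\<dots> = integral\<^sup>L (M1 \<Otimes>\<^sub>M M2) (\<lambda>(t, s). a' t * c' s)"
    using F.integral_fst[of "\<lambda>t s. a' t * c' s"] full by simp
  also have "(\<lambda>(t, s). a' t * c' s) = (\<lambda>p. case_prod below p + case_prod above p)"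
    by (auto simp: below_def above_def fun_eq_iff)
  also have "integral\<^sup>L (M1 \<Otimes>\<^sub>M M2) \<dots>
      = integral\<^sup>L (M1 \<Otimes>\<^sub>M M2) (case_prod below) + integral\<^sup>L (M1 \<Otimes>\<^sub>M M2) (case_prod above)"
    by (rule Bochner_Integration.integral_add[OF below_int above_int])
  also have "integral\<^sup>L (M1 \<Otimes>\<^sub>M M2) (case_prod below) = (LINT t|M1. LINT s|M2. below t s)"
    using F.integral_fst[OF below_int] by simp
  also have "\<dots> = (LINT t:{0..<x}|M1. a t * (LINT s:{0..<t}|M2. c s))"
    unfolding set_lebesgue_integral_def
  proof (rule Bochner_Integration.integral_cong[OF refl])
    fix t assume "t \<in> space M1"
    have "(LINT s|M2. below t s) = (LINT s|M2. a' t * (indicator {0..<t} s *\<^sub>R c s))"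
      unfolding below_def a'_def c'_def
      by (intro Bochner_Integration.integral_cong) (auto simp: ray_def split: split_indicator)
    then show "(LINT s|M2. below t s) = indicator {0..<x} t *\<^sub>R (a t * (LINT s|M2. indicator {0..<t} s *\<^sub>R c s))"
      by (simp only: integral_mult_right_zero) (simp only: a'_def mult_scaleR_left)
  qed
  also have "integral\<^sup>L (M1 \<Otimes>\<^sub>M M2) (case_prod above) = (LINT s|M2. LINT t|M1. above t s)"
    using F.integral_snd[OF above_int] by simp
  also have "\<dots> = (LINT s:{0..<x}|M2. (LINT t:{0..<s}|M1. a t) * c s)"
    unfolding set_lebesgue_integral_def
  proof (rule integral_cong_AE)
    show "(\<lambda>s. LINT t|M1. above t s) \<in> borel_measurable M2"
      by (rule F.M1.borel_measurable_lebesgue_integral)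
         (use measurable_compose[OF measurable_pair_swap' above_meas] in \<open>simp add: split_beta'\<close>)
    have "(\<lambda>s. LINT t:{0..<s}|M1. a t) \<in> borel_measurable M2"
      by (intro S1.primitive_measurable) (simp_all add: S2.sets_LS)
    then show "(\<lambda>s. indicator {0..<x} s *\<^sub>R ((LINT t|M1. indicator {0..<s} t *\<^sub>R a t) * c s)) \<in> borel_measurable M2"
      unfolding set_lebesgue_integral_def by measurable
    show "AE s in M2. (LINT t|M1. above t s) = indicator {0..<x} s *\<^sub>R ((LINT t|M1. indicator {0..<s} t *\<^sub>R a t) * c s)"
      using AE_M2_closed_initial[OF a] AE_space
    proof eventually_elim
      case (elim s)
      have "(LINT t|M1. above t s) = (LINT t|M1. (indicator {0..s} t *\<^sub>R a t) * c' s)"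
        unfolding above_def a'_def c'_def
        by (intro Bochner_Integration.integral_cong) (auto simp: ray_def split: split_indicator)
      also have "\<dots> = (LINT t:{0..s}|M1. a t) * c' s"
        unfolding set_lebesgue_integral_def by (simp only: integral_mult_left_zero)
      also have "\<dots> = (LINT t:{0..<s}|M1. a t) * c' s"
        using elim by simp
      finally show ?case by (simp add: c'_def set_lebesgue_integral_def)
    qed
  qed
  finally show ?thesis
    by (simp add: a'_def c'_def set_lebesgue_integral_def)
qed

text \<open>The equations of a triple for a right-hand side that is merely locally integrable. Solutions
  for a spectral parameter and their linear combinations have this form before
  anything is known about their square integrability.\<close>

definition solves :: "(real \<Rightarrow> complex) \<Rightarrow> (real \<Rightarrow> complex) \<Rightarrow> (real \<Rightarrow> complex) \<Rightarrow> bool" where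
  "solves u1 u2 f \<longleftrightarrow> loc_int b M2 f \<and>
     (\<forall>x\<in>ray b. u1 x = u1 0 + (LINT t:{0..<x}|M1. u2 t) \<and>
                u2 x = u2 0 - (LINT t:{0..<x}|M2. f t))"

lemma solvesD:
  assumes "solves u1 u2 f"
  shows "loc_int b M2 f"
    and "x \<in> ray b \<Longrightarrow> u1 x = u1 0 + (LINT t:{0..<x}|M1. u2 t)"
    and "x \<in> ray b \<Longrightarrow> u2 x = u2 0 - (LINT t:{0..<x}|M2. f t)"
  using assms by (auto simp: solves_def)

lemma measurable_ray_cong:
  assumes "sets N = sets (restrict_space borel (ray b))" "\<And>x. x \<in> ray b \<Longrightarrow> f x = g x"
  shows "f \<in> borel_measurable N \<longleftrightarrow> g \<in> borel_measurable N"
  using assms sets_eq_imp_space_eq[OF assms(1)]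
  by (intro measurable_cong) (auto simp: space_restrict_space)

lemma solves_regularity:
  assumes "solves u1 u2 f" and N: "sets N = sets (restrict_space borel (ray b))"
  shows "u1 \<in> borel_measurable N" "u2 \<in> borel_measurable N" "loc_bdd b u1" "loc_bdd b u2"
proof -
  note s = solvesD[OF assms(1)]
  have m2: "u2 \<in> borel_measurable N'" if N': "sets N' = sets (restrict_space borel (ray b))" for N'
  proof -
    have [measurable]: "(\<lambda>x. LINT t:{0..<x}|M2. f t) \<in> borel_measurable N'"
      using loc_int_measurable[OF s(1)] N' by (rule S2.primitive_measurable)
    have "(\<lambda>x. u2 0 - (LINT t:{0..<x}|M2. f t)) \<in> borel_measurable N'" by measurable
    then show ?thesis using s(3) by (subst measurable_ray_cong[OF N']) auto
  qed
  show "u2 \<in> borel_measurable N" using N by (rule m2)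
  have "loc_bdd b (\<lambda>x. u2 0 - (LINT t:{0..<x}|M2. f t))"
    by (intro loc_bdd_diff S2.primitive_bdd[OF s(1)]) simp
  then show b2: "loc_bdd b u2" by (subst loc_bdd_cong[OF s(3)])
  have i2: "loc_int b M1 u2"
    using m2[OF S1.sets_LS] b2 by (rule S1.loc_int_bounded)
  have [measurable]: "(\<lambda>x. LINT t:{0..<x}|M1. u2 t) \<in> borel_measurable N"
    using loc_int_measurable[OF i2] N by (rule S1.primitive_measurable)
  have "(\<lambda>x. u1 0 + (LINT t:{0..<x}|M1. u2 t)) \<in> borel_measurable N" by measurable
  then show "u1 \<in> borel_measurable N" using s(2) by (subst measurable_ray_cong[OF N]) auto
  have "loc_bdd b (\<lambda>x. u1 0 + (LINT t:{0..<x}|M1. u2 t))"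
    by (intro loc_bdd_add S1.primitive_bdd[OF i2]) simp
  then show "loc_bdd b u1" by (subst loc_bdd_cong[OF s(2)])
qed

lemma solves_loc_int:
  assumes "solves u1 u2 f"
  shows "loc_int b M1 u2" "loc_int b M2 u1"
  using solves_regularity[OF assms S1.sets_LS] solves_regularity[OF assms S2.sets_LS]
  by (auto intro: S1.loc_int_bounded S2.loc_int_bounded)

lemma solves_cnj:
  assumes "solves u1 u2 f"
  shows "solves (\<lambda>x. cnj (u1 x)) (\<lambda>x. cnj (u2 x)) (\<lambda>x. cnj (f x))"
  unfolding solves_def
proof (intro conjI ballI)
  fix x assume x: "x \<in> ray b"
  show "cnj (u1 x) = cnj (u1 0) + (LINT t:{0..<x}|M1. cnj (u2 t))"
    unfolding initial_integral_cnj solvesD(2)[OF assms x] complex_cnj_add ..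
  show "cnj (u2 x) = cnj (u2 0) - (LINT t:{0..<x}|M2. cnj (f t))"
    unfolding initial_integral_cnj solvesD(3)[OF assms x] complex_cnj_diff ..
qed (use solvesD(1)[OF assms] in auto)

lemma solves_linear:
  assumes u: "solves u1 u2 f" and v: "solves v1 v2 g"
  shows "solves (\<lambda>x. p * u1 x + q * v1 x) (\<lambda>x. p * u2 x + q * v2 x) (\<lambda>x. p * f x + q * g x)"
  unfolding solves_def
proof (intro conjI ballI)
  note iu = solves_loc_int[OF u] solvesD(1)[OF u] and iv = solves_loc_int[OF v] solvesD(1)[OF v]
  show "loc_int b M2 (\<lambda>x. p * f x + q * g x)" using iu iv by auto
  fix x assume x: "x \<in> ray b"
  have 1: "(LINT t:{0..<x}|M1. p * u2 t + q * v2 t)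
      = p * (LINT t:{0..<x}|M1. u2 t) + q * (LINT t:{0..<x}|M1. v2 t)"
    using loc_intD[OF iu(1) x] loc_intD[OF iv(1) x] by (subst set_integral_add) auto
  show "p * u1 x + q * v1 x = p * u1 0 + q * v1 0 + (LINT t:{0..<x}|M1. p * u2 t + q * v2 t)"
    unfolding 1 solvesD(2)[OF u x] solvesD(2)[OF v x] by (simp add: algebra_simps)
  have 2: "(LINT t:{0..<x}|M2. p * f t + q * g t)
      = p * (LINT t:{0..<x}|M2. f t) + q * (LINT t:{0..<x}|M2. g t)"
    using loc_intD[OF iu(3) x] loc_intD[OF iv(3) x] by (subst set_integral_add) auto
  show "p * u2 x + q * v2 x = p * u2 0 + q * v2 0 - (LINT t:{0..<x}|M2. p * f t + q * g t)"
    unfolding 2 solvesD(3)[OF u x] solvesD(3)[OF v x] by (simp add: algebra_simps)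
qed

lemma solves_constant: "solves (\<lambda>_. 1) (\<lambda>_. 0) (\<lambda>_. 0)"
  by (simp add: solves_def S2.loc_int_const)

lemma solves_R1: "solves (\<lambda>x. complex_of_real (R1 x)) (\<lambda>_. 1) (\<lambda>_. 0)"
  unfolding solves_def
proof (intro conjI ballI)
  fix x assume x: "x \<in> ray b"
  have "(LINT t:{0..<x}|M1. (1::complex)) = complex_of_real (measure M1 {0..<x})"
    using S1.sets_initial[OF x] S1.emeasure_initial_finite[OF x] by (simp add: set_integral_const scaleR_conv_of_real)
  then show "complex_of_real (R1 x) = complex_of_real (R1 0) + (LINT t:{0..<x}|M1. 1)"
    by (simp add: S1.measure_initial[OF x] S1.R_zero)
qed (simp_all add: S2.loc_int_const)

text \<open>Integration by parts with initial values. There is no correction term for jumps, since those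
  of \<open>u\<^sub>1\<close> and \<open>v\<^sub>2\<close> never coincide.\<close>

lemma product_formula:
  assumes u: "solves u1 u2 f" and v: "solves v1 v2 g" and x: "x \<in> ray b"
  shows "u1 x * v2 x = u1 0 * v2 0 + (LINT t:{0..<x}|M1. u2 t * v2 t) - (LINT t:{0..<x}|M2. u1 t * g t)"
proof -
  note a = solves_loc_int(1)[OF u] and c = solvesD(1)[OF v]
  define A where "A x = (LINT t:{0..<x}|M1. u2 t)" for x
  define C where "C x = (LINT t:{0..<x}|M2. g t)" for x
  have u1: "u1 t = u1 0 + A t" and v2: "v2 t = v2 0 - C t" if "t \<in> ray b" for t
    using that solvesD(2)[OF u] solvesD(3)[OF v] by (simp_all add: A_def C_def)
  have cut: "t \<in> ray b" if "t \<in> {0..<x}" for t using that x by (auto intro: ray_downward)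
  have CM: "loc_int b M1 (\<lambda>t. C t * u2 t)"
    unfolding C_def using a
    by (rule S1.loc_int_mult[OF S2.primitive_measurable[OF loc_int_measurable[OF c] S1.sets_LS] S2.primitive_bdd[OF c]])
  have AM: "loc_int b M2 (\<lambda>t. A t * g t)"
    unfolding A_def using c
    by (rule S2.loc_int_mult[OF S1.primitive_measurable[OF loc_int_measurable[OF a] S2.sets_LS] S1.primitive_bdd[OF a]])
  have e1: "u2 t * v2 t = v2 0 * u2 t - C t * u2 t" and e2: "u1 t * g t = u1 0 * g t + A t * g t"
    if "t \<in> {0..<x}" for t
    unfolding v2[OF cut[OF that]] u1[OF cut[OF that]] by (simp_all add: algebra_simps)
  have "(LINT t:{0..<x}|M1. u2 t * v2 t) = (LINT t:{0..<x}|M1. v2 0 * u2 t - C t * u2 t)"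
    unfolding set_lebesgue_integral_def
    by (intro Bochner_Integration.integral_cong) (auto simp: e1 split: split_indicator)
  also have "\<dots> = v2 0 * A x - (LINT t:{0..<x}|M1. u2 t * C t)"
    using loc_intD[OF CM x] loc_intD[OF a x] by (subst set_integral_diff) (auto simp: A_def mult.commute)
  finally have 1: "(LINT t:{0..<x}|M1. u2 t * v2 t) = v2 0 * A x - (LINT t:{0..<x}|M1. u2 t * C t)" .
  have "(LINT t:{0..<x}|M2. u1 t * g t) = (LINT t:{0..<x}|M2. u1 0 * g t + A t * g t)"
    unfolding set_lebesgue_integral_def
    by (intro Bochner_Integration.integral_cong) (auto simp: e2 split: split_indicator)
  also have "\<dots> = u1 0 * C x + (LINT t:{0..<x}|M2. A t * g t)"
    using loc_intD[OF AM x] loc_intD[OF c x] by (subst set_integral_add) (auto simp: C_def)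
  finally have 2: "(LINT t:{0..<x}|M2. u1 t * g t) = u1 0 * C x + (LINT t:{0..<x}|M2. A t * g t)" .
  have "A x * C x = (LINT t:{0..<x}|M1. u2 t * C t) + (LINT t:{0..<x}|M2. A t * g t)"
    unfolding A_def C_def by (rule integration_by_parts[OF a c x])
  then show ?thesis
    unfolding 1 2 u1[OF x] v2[OF x] by (simp add: algebra_simps)
qed

lemma lagrange_identity:
  assumes u: "solves u1 u2 f" and v: "solves v1 v2 g" and x: "x \<in> ray b"
  shows "u1 x * v2 x - u2 x * v1 x
    = u1 0 * v2 0 - u2 0 * v1 0 + (LINT t:{0..<x}|M2. f t * v1 t - u1 t * g t)"
proof -
  have "loc_int b M2 (\<lambda>t. v1 t * f t)" "loc_int b M2 (\<lambda>t. u1 t * g t)"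
    using S2.loc_int_mult solves_regularity[OF v S2.sets_LS] solves_regularity[OF u S2.sets_LS]
      solvesD(1)[OF u] solvesD(1)[OF v] by auto
  then have "(LINT t:{0..<x}|M2. f t * v1 t - u1 t * g t)
      = (LINT t:{0..<x}|M2. v1 t * f t) - (LINT t:{0..<x}|M2. u1 t * g t)"
    using x by (subst set_integral_diff) (auto simp: mult.commute loc_intD)
  then show ?thesis
    using product_formula[OF u v x] product_formula[OF v u x]
    by (simp add: mult.commute[of "v2 _"] mult.commute[of "v1 _"])
qed

text \<open>The Lagrange identity against the solution \<open>(R\<^sub>1, 1)\<close> of the homogeneous system. It expresses
  \<open>u\<^sub>1\<close> without the iterated integral in its definition.\<close>

lemma first_component_formula:
  assumes u: "solves u1 u2 f" and x: "x \<in> ray b"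
  shows "u1 x = u1 0 + complex_of_real (R1 x) * u2 x + (LINT t:{0..<x}|M2. f t * complex_of_real (R1 t))"
  using lagrange_identity[OF u solves_R1 x] S1.R_zero by (simp add: mult.commute[of "u2 x"] diff_eq_eq add_ac)

end

section \<open>Square integrable functions and their classes\<close>

lemma sq_int_mult_integrable:
  assumes f: "f \<in> sq_int N" and g: "g \<in> sq_int N"
  shows "integrable N (\<lambda>x. f x * g x)"
proof -
  have "integrable N (\<lambda>x. (cmod (f x))\<^sup>2 + (cmod (g x))\<^sup>2)"
    using assms by (auto simp: sq_int_def)
  then show ?thesis
  proof (rule Bochner_Integration.integrable_bound)
    show "(\<lambda>x. f x * g x) \<in> borel_measurable N"
      using assms by (auto simp: sq_int_def)
    show "AE x in N. norm (f x * g x) \<le> norm ((cmod (f x))\<^sup>2 + (cmod (g x))\<^sup>2)"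
    proof (rule AE_I2)
      fix x
      have "0 \<le> (cmod (f x) - cmod (g x))\<^sup>2" by simp
      then have "2 * (cmod (f x) * cmod (g x)) \<le> (cmod (f x))\<^sup>2 + (cmod (g x))\<^sup>2"
        by (simp add: power2_diff)
      moreover have "0 \<le> cmod (f x) * cmod (g x)" by simp
      ultimately have "cmod (f x) * cmod (g x) \<le> (cmod (f x))\<^sup>2 + (cmod (g x))\<^sup>2" by linarith
      then show "norm (f x * g x) \<le> norm ((cmod (f x))\<^sup>2 + (cmod (g x))\<^sup>2)"
        by (simp add: norm_mult)
    qed
  qed
qed

lemma sq_int_bound:
  assumes f: "f \<in> borel_measurable N" and g: "g \<in> sq_int N"
    and le: "AE x in N. cmod (f x) \<le> cmod (g x)"
  shows "f \<in> sq_int N"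
proof -
  have "integrable N (\<lambda>x. (cmod (g x))\<^sup>2)" using g by (simp add: sq_int_def)
  then have "integrable N (\<lambda>x. (cmod (f x))\<^sup>2)"
  proof (rule Bochner_Integration.integrable_bound)
    show "AE x in N. norm ((cmod (f x))\<^sup>2) \<le> norm ((cmod (g x))\<^sup>2)"
      using le by eventually_elim (simp add: power_mono)
  qed (use f in measurable)
  then show ?thesis using f by (simp add: sq_int_def)
qed

lemma sq_int_cnj: "f \<in> sq_int N \<Longrightarrow> (\<lambda>x. cnj (f x)) \<in> sq_int N"
  by (rule sq_int_bound[where g=f])
     (auto simp: sq_int_def intro: borel_measurable_continuous_on[OF continuous_on_cnj[OF continuous_on_id]])

lemma sq_int_cmult: 
  assumes "f \<in> sq_int N" shows "(\<lambda>x. c * f x) \<in> sq_int N"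
  using assms by (auto simp: sq_int_def norm_mult power_mult_distrib)

lemma sq_int_add:
  assumes f: "f \<in> sq_int N" and g: "g \<in> sq_int N"
  shows "(\<lambda>x. f x + g x) \<in> sq_int N"
proof -
  have "integrable N (\<lambda>x. 2 * (cmod (f x))\<^sup>2 + 2 * (cmod (g x))\<^sup>2)"
    using assms by (auto simp: sq_int_def)
  then have "integrable N (\<lambda>x. (cmod (f x + g x))\<^sup>2)"
  proof (rule Bochner_Integration.integrable_bound)
    show "(\<lambda>x. (cmod (f x + g x))\<^sup>2) \<in> borel_measurable N"
      using assms by (auto simp: sq_int_def)
    show "AE x in N. norm ((cmod (f x + g x))\<^sup>2) \<le> norm (2 * (cmod (f x))\<^sup>2 + 2 * (cmod (g x))\<^sup>2)"
    proof (rule AE_I2)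
      fix x
      have "(cmod (f x + g x))\<^sup>2 \<le> (cmod (f x) + cmod (g x))\<^sup>2"
        by (intro power_mono norm_triangle_ineq) simp
      moreover have "0 \<le> (cmod (f x) - cmod (g x))\<^sup>2" by simp
      ultimately have "(cmod (f x + g x))\<^sup>2 \<le> 2 * (cmod (f x))\<^sup>2 + 2 * (cmod (g x))\<^sup>2"
        by (simp add: power2_diff power2_sum)
      then show "norm ((cmod (f x + g x))\<^sup>2) \<le> norm (2 * (cmod (f x))\<^sup>2 + 2 * (cmod (g x))\<^sup>2)"
        by simp
    qed
  qed
  then show ?thesis using assms by (auto simp: sq_int_def)
qed

lemma sq_int_diff: "f \<in> sq_int N \<Longrightarrow> g \<in> sq_int N \<Longrightarrow> (\<lambda>x. f x - g x) \<in> sq_int N"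
  using sq_int_add[of f N "\<lambda>x. - 1 * g x"] sq_int_cmult[of g N "-1"] by simp

lemma cls_eqD: "cls N f = cls N g \<Longrightarrow> f \<in> sq_int N \<Longrightarrow> AE x in N. f x = g x"
  unfolding cls_def by blast

lemma cls_eqI: "AE x in N. f x = g x \<Longrightarrow> cls N f = cls N g"
proof -
  assume eq: "AE x in N. f x = g x"
  have "(AE x in N. h x = f x) \<longleftrightarrow> (AE x in N. h x = g x)" for h
  proof
    assume "AE x in N. h x = f x" with eq show "AE x in N. h x = g x" by eventually_elim simp
  next
    assume "AE x in N. h x = g x" with eq show "AE x in N. h x = f x" by eventually_elim simp
  qed
  then show "cls N f = cls N g" by (simp add: cls_def)
qed

lemma (in stieltjes) sq_int_loc_int:
  assumes f: "f \<in> sq_int M"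
  shows "loc_int b M f"
  unfolding loc_int_def
proof (intro conjI ballI)
  fix x assume x: "x \<in> ray b"
  have ind: "(\<lambda>t. complex_of_real (indicator {0..<x} t)) \<in> sq_int M"
  proof -
    have "(\<lambda>t. (cmod (complex_of_real (indicator {0..<x} t)))\<^sup>2) = indicator {0..<x}"
      by (auto split: split_indicator)
    then show ?thesis
      using emeasure_initial_finite[OF x] sets_initial[OF x]
      by (simp add: sq_int_def integrable_real_indicator borel_measurable_indicator)
  qed
  show "set_integrable M {0..<x} f"
    using sq_int_mult_integrable[OF ind f] by (simp add: set_integrable_def scaleR_conv_of_real)
qed (use f in \<open>simp add: sq_int_def\<close>)

section \<open>Limit circle case: the solutions at zero are square integrable\<close>

context stieltjes_pair
begin

lemma triples_iff:
  "(u1, u2, f) \<in> triples b R1 R2 \<longleftrightarrow> u1 \<in> sq_int M2 \<and> f \<in> sq_int M2 \<and> solves u1 u2 f"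
  using S2.sq_int_loc_int by (auto simp: triples_def solves_def)

lemma solves_cong_AE:
  assumes u: "solves u1 u2 f" and g: "loc_int b M2 g" and eq: "AE x in M2. f x = g x"
  shows "solves u1 u2 g"
proof -
  have "(LINT t:{0..<x}|M2. f t) = (LINT t:{0..<x}|M2. g t)" if "x \<in> ray b" for x
    using loc_intD[OF solvesD(1)[OF u] that] loc_intD[OF g that] eq
    unfolding set_integrable_def set_lebesgue_integral_def
    by (intro integral_cong_AE) (auto dest: borel_measurable_integrable)
  then show ?thesis using u g by (simp add: solves_def)
qed

text \<open>Inserting the second equation into the first bounds \<open>|y\<^sub>1(x)|\<close> by \<open>R\<^sub>1(x) |z|\<close> times the
  integral of \<open>|y\<^sub>1|\<close> over \<open>[0,x)\<close>, so a Gronwall inequality for the single measure \<open>dR\<^sub>2\<close> suffices.\<close>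

lemma homogeneous_unique:
  assumes y: "solves y1 y2 (\<lambda>x. z * y1 x)" and init: "y1 0 = 0" "y2 0 = 0"
    and X: "X \<in> ray b"
  shows "y1 X = 0"
proof -
  define G where "G x = (LINT t:{0..<x}|M2. norm (y1 t))" for x
  have loc: "loc_int b M2 (\<lambda>t. norm (y1 t))" using solves_loc_int(2)[OF y] by auto
  have "norm (y1 X) = 0"
  proof (rule S2.gronwall_zero[OF loc _ X])
    fix x assume x: "0 \<le> x" "x \<le> X"
    have xr: "x \<in> ray b" using X x by (rule ray_downward)
    have y2: "norm (y2 t) \<le> norm z * G x" if t: "t \<in> {0..<x}" for t
    proof -
      have tr: "t \<in> ray b" using xr t by (auto intro: ray_downward)
      have "norm (y2 t) = norm (LINT s:{0..<t}|M2. z * y1 s)"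
        using solvesD(3)[OF y tr] init by simp
      also have "\<dots> = norm z * norm (LINT s:{0..<t}|M2. y1 s)"
        by (simp add: norm_mult)
      also have "\<dots> \<le> norm z * G t"
        unfolding G_def using solves_loc_int(2)[OF y] tr
        by (intro mult_left_mono S2.primitive_norm_le) auto
      also have "\<dots> \<le> norm z * G x"
        unfolding G_def using t xr by (intro mult_left_mono S2.primitive_mono[OF loc]) auto
      finally show ?thesis .
    qed
    have Gnn: "0 \<le> G x" unfolding G_def by (rule S2.primitive_nonneg) simp
    have "norm (y1 x) = norm (LINT t:{0..<x}|M1. y2 t)"
      using solvesD(2)[OF y xr] init by simp
    also have "\<dots> \<le> (LINT t:{0..<x}|M1. norm (y2 t))"
      by (rule S1.primitive_norm_le[OF solves_loc_int(1)[OF y] xr])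
    also have "\<dots> \<le> (LINT t:{0..<x}|M1. norm z * G x)"
      using y2 loc_intD[OF loc_int_norm[OF solves_loc_int(1)[OF y]] xr] loc_intD[OF S1.loc_int_const xr]
      by (intro set_integral_mono)
    also have "\<dots> = R1 x * (norm z * G x)"
      using S1.sets_initial[OF xr] S1.emeasure_initial_finite[OF xr]
      by (simp add: set_integral_const S1.measure_initial[OF xr])
    also have "\<dots> \<le> R1 X * (norm z * G x)"
      using mono_onD[OF S1.R_mono xr X x(2)] Gnn by (intro mult_right_mono) auto
    finally show "norm (y1 x) \<le> R1 X * norm z * (LINT t:{0..<x}|M2. norm (y1 t))"
      by (simp add: G_def mult.assoc)
  qed simp
  then show ?thesis by simp
qed

text \<open>Variation of constants: with the constant Wronskian \<open>W\<close> of \<open>u\<close> and \<open>v\<close>,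
  \<open>W w\<^sub>1 = u\<^sub>1 (w\<^sub>1 v\<^sub>2 - w\<^sub>2 v\<^sub>1) - v\<^sub>1 (w\<^sub>1 u\<^sub>2 - w\<^sub>2 u\<^sub>1)\<close>, and the Lagrange
  identity turns the brackets into a constant minus \<open>z\<close> times a primitive of \<open>w\<^sub>1 v\<^sub>1\<close> or \<open>w\<^sub>1 u\<^sub>1\<close>.\<close>

lemma sq_int_solution_at_zero:
  assumes u: "solves u1 u2 (\<lambda>x. z * u1 x)" "u1 \<in> sq_int M2"
    and v: "solves v1 v2 (\<lambda>x. z * v1 x)" "v1 \<in> sq_int M2"
    and W: "u1 0 * v2 0 - u2 0 * v1 0 \<noteq> 0"
    and w: "solves w1 w2 (\<lambda>_. 0)"
  shows "w1 \<in> sq_int M2"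
proof -
  define W where "W = u1 0 * v2 0 - u2 0 * v1 0"
  define m where "m x = cmod (u1 x) + cmod (v1 x)" for x
  define C where "C = cmod (w1 0 * v2 0 - w2 0 * v1 0) + cmod (w1 0 * u2 0 - w2 0 * u1 0)"
  \<comment> \<open>The factor \<open>K \<ge> 1\<close> absorbs all constants into \<open>g\<close>. It also appears inside the integral of
    the inequality, where it only enlarges the bound.\<close>
  define K where "K = max 1 (max (C / cmod W) (cmod z / cmod W))"
  define g where "g x = K * m x" for x
  have W0: "0 < cmod W" using W by (simp add: W_def)
  have K: "1 \<le> K" "C \<le> K * cmod W" "cmod z \<le> K * cmod W"
    using W0 by (auto simp: K_def le_max_iff_disj pos_divide_le_eq[symmetric])
  note ru = solves_regularity[OF u(1) S2.sets_LS]
    and rv = solves_regularity[OF v(1) S2.sets_LS]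
    and rw = solves_regularity[OF w S2.sets_LS]
  note [measurable] = ru(1,2) rv(1,2) rw(1,2)
  have m_meas [measurable]: "m \<in> borel_measurable M2" unfolding m_def[abs_def] by measurable
  have m_bdd: "loc_bdd b m"
    unfolding m_def[abs_def] using ru(3) rv(3) by (intro loc_bdd_add) auto
  have wm: "loc_int b M2 (\<lambda>t. cmod (w1 t) * m t)"
    using m_bdd rw(3) by (intro S2.loc_int_bounded loc_bdd_mult) (simp_all, measurable)
  define J where "J x = (LINT t:{0..<x}|M2. cmod (w1 t) * m t)" for x
  have cross: "cmod (w1 x * s2 x - w2 x * s1 x) \<le> cmod (w1 0 * s2 0 - w2 0 * s1 0) + cmod z * J x"
    if s: "solves s1 s2 (\<lambda>x. z * s1 x)" and le: "\<And>t. cmod (s1 t) \<le> m t" and x: "x \<in> ray b" for s1 s2 x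
  proof -
    note [measurable] = solves_regularity(1,2)[OF s S2.sets_LS]
    have ws: "loc_int b M2 (\<lambda>t. w1 t * s1 t)"
      using solves_regularity(3)[OF s S2.sets_LS] rw(3)
      by (intro S2.loc_int_bounded loc_bdd_mult) (simp_all, measurable)
    have "w1 x * s2 x - w2 x * s1 x
        = w1 0 * s2 0 - w2 0 * s1 0 + (LINT t:{0..<x}|M2. - z * (w1 t * s1 t))"
      using lagrange_identity[OF w s x] by (simp add: ac_simps)
    also have "(LINT t:{0..<x}|M2. - z * (w1 t * s1 t)) = - z * (LINT t:{0..<x}|M2. w1 t * s1 t)"
      by (rule set_integral_mult_right)
    finally have "cmod (w1 x * s2 x - w2 x * s1 x)
        \<le> cmod (w1 0 * s2 0 - w2 0 * s1 0) + cmod z * cmod (LINT t:{0..<x}|M2. w1 t * s1 t)"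
      by (metis norm_triangle_ineq norm_mult norm_minus_cancel)
    also have "cmod (LINT t:{0..<x}|M2. w1 t * s1 t) \<le> (LINT t:{0..<x}|M2. cmod (w1 t * s1 t))"
      using ws x by (rule S2.primitive_norm_le)
    also have "\<dots> \<le> J x"
      unfolding J_def using loc_intD[OF loc_int_norm[OF ws] x] loc_intD[OF wm x] le
      by (intro set_integral_mono) (auto simp: norm_mult intro: mult_left_mono)
    finally show ?thesis by (simp add: mult_left_mono)
  qed
  have bound: "cmod (w1 x) \<le> g x * (1 + (LINT t:{0..<x}|M2. cmod (w1 t) * g t))" if x: "x \<in> ray b" for x
  proof -
    have J: "0 \<le> J x" unfolding J_def by (rule S2.primitive_nonneg) (simp add: m_def)
    have m0: "0 \<le> m x" by (simp add: m_def)
    have Wx: "u1 x * v2 x - u2 x * v1 x = W"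
      using lagrange_identity[OF u(1) v(1) x] by (simp add: W_def mult.assoc mult.left_commute)
    have "W * w1 x = u1 x * (w1 x * v2 x - w2 x * v1 x) - v1 x * (w1 x * u2 x - w2 x * u1 x)"
      unfolding Wx[symmetric] by (simp add: algebra_simps)
    moreover have cv: "cmod (w1 x * v2 x - w2 x * v1 x) \<le> C + cmod z * J x"
      by (rule order.trans[OF cross[OF v(1) _ x]]) (simp_all add: m_def C_def)
    moreover have cu: "cmod (w1 x * u2 x - w2 x * u1 x) \<le> C + cmod z * J x"
      by (rule order.trans[OF cross[OF u(1) _ x]]) (simp_all add: m_def C_def)
    ultimately have "cmod W * cmod (w1 x)
        \<le> cmod (u1 x) * cmod (w1 x * v2 x - w2 x * v1 x) + cmod (v1 x) * cmod (w1 x * u2 x - w2 x * u1 x)"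
      by (metis norm_triangle_ineq4 norm_mult)
    also have "\<dots> \<le> cmod (u1 x) * (C + cmod z * J x) + cmod (v1 x) * (C + cmod z * J x)"
      using cv cu by (intro add_mono mult_left_mono) auto
    also have "\<dots> = m x * (C + cmod z * J x)" by (simp add: m_def algebra_simps)
    also have "\<dots> \<le> m x * (K * cmod W + K * cmod W * J x)"
      using K J m0 by (intro mult_left_mono add_mono mult_right_mono) auto
    also have "\<dots> = cmod W * (g x * (1 + J x))" by (simp add: g_def algebra_simps)
    finally have "cmod (w1 x) \<le> g x * (1 + J x)" using W0 by simp
    also have "\<dots> \<le> g x * (1 + K * J x)"
      using K J m0 mult_right_mono[of 1 K "J x"] by (intro mult_left_mono add_mono) (auto simp: g_def)
    also have "K * J x = (LINT t:{0..<x}|M2. K * (cmod (w1 t) * m t))"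
      by (simp add: J_def)
    also have "\<dots> = (LINT t:{0..<x}|M2. cmod (w1 t) * g t)"
      by (simp add: g_def ac_simps)
    finally show ?thesis .
  qed
  have "integrable M2 (\<lambda>t. (cmod (w1 t))\<^sup>2)"
  proof (rule S2.gronwall_square_integrable[of _ g])
    show "loc_int b M2 (\<lambda>t. cmod (w1 t))" using solves_loc_int(2)[OF w] by auto
    show "loc_bdd b (\<lambda>t. cmod (w1 t))" using rw(3) by simp
    show "g \<in> borel_measurable M2" unfolding g_def[abs_def] by measurable
    show "loc_bdd b g" unfolding g_def[abs_def] using m_bdd by (intro loc_bdd_mult) auto
    show "0 \<le> g t" for t using K by (simp add: g_def m_def)
    have "(\<lambda>t. complex_of_real (m t)) \<in> sq_int M2"
    proof -
      have "(\<lambda>t. complex_of_real (cmod (u1 t))) \<in> sq_int M2" "(\<lambda>t. complex_of_real (cmod (v1 t))) \<in> sq_int M2"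
        using u(2) v(2) by (auto simp: sq_int_def)
      from sq_int_add[OF this] show ?thesis by (simp add: m_def)
    qed
    then have "(\<lambda>t. complex_of_real K * complex_of_real (m t)) \<in> sq_int M2" by (rule sq_int_cmult)
    then show "integrable M2 (\<lambda>t. (g t)\<^sup>2)"
      by (simp add: sq_int_def g_def norm_mult power_mult_distrib)
  qed (use bound in auto)
  then show ?thesis using rw(1) by (simp add: sq_int_def)
qed

text \<open>Elements of the kernel are represented by solutions up to null sets. A vanishing Wronskian at \<open>0\<close>
  would give a nontrivial combination with zero initial values; by uniqueness it vanishes, against the
  independence of the classes.\<close>

lemma limit_circle_solutions:
  assumes "limit_circle b R1 R2"
  obtains z u1 u2 v1 v2 where
    "solves u1 u2 (\<lambda>x. z * u1 x)" "u1 \<in> sq_int M2"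
    "solves v1 v2 (\<lambda>x. z * v1 x)" "v1 \<in> sq_int M2"
    "u1 0 * v2 0 - u2 0 * v1 0 \<noteq> 0"
proof -
  obtain z where dim: "cls_dim M2 (rel_ker M2 (rel_minus M2 (T_max b R1 R2) z)) 2"
    using assms by (auto simp: limit_circle_def)
  then obtain \<phi> :: "nat \<Rightarrow> real \<Rightarrow> complex" where indep: "cls_independent M2 2 \<phi>"
    and ker: "rel_ker M2 (rel_minus M2 (T_max b R1 R2) z)
        = {cls M2 (\<lambda>x. \<Sum>i<2. c i * \<phi> i x) | c :: nat \<Rightarrow> complex. True}"
    by (auto simp: cls_dim_def)
  have sol: "\<exists>u1 u2. solves u1 u2 (\<lambda>x. z * u1 x) \<and> u1 \<in> sq_int M2 \<and> (AE x in M2. \<phi> j x = u1 x)" if j: "j < 2" for j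
  proof -
    have \<phi>: "\<phi> j \<in> sq_int M2" using indep j by (simp add: cls_independent_def)
    have "(\<lambda>x. \<Sum>i<2. (if i = j then 1 else 0) * \<phi> i x) = \<phi> j"
      using j by (auto simp: numeral_2_eq_2 less_Suc_eq)
    then have "cls M2 (\<phi> j) \<in> rel_ker M2 (rel_minus M2 (T_max b R1 R2) z)"
      unfolding ker by (intro CollectI exI[of _ "\<lambda>i. if i = j then 1 else 0"]) simp
    then obtain u f where uf: "u \<in> sq_int M2" "f \<in> sq_int M2" "(cls M2 u, cls M2 f) \<in> T_max b R1 R2"
      "cls M2 (\<phi> j) = cls M2 u" "cls M2 (\<lambda>_. 0) = cls M2 (\<lambda>x. f x - z * u x)"
      by (auto simp: rel_ker_def rel_minus_def)
    then obtain u1 u2 f' where t: "(u1, u2, f') \<in> triples b R1 R2"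
      and eq: "cls M2 u = cls M2 u1" "cls M2 f = cls M2 f'"
      by (auto simp: T_max_def)
    have "AE x in M2. u x = u1 x" "AE x in M2. f x = f' x" "AE x in M2. \<phi> j x = u x"
      by (rule cls_eqD[OF eq(1) uf(1)], rule cls_eqD[OF eq(2) uf(2)], rule cls_eqD[OF uf(4) \<phi>])
    note ae1 = this
    have ae2: "AE x in M2. 0 = f x - z * u x"
      by (rule cls_eqD[OF uf(5)]) (simp add: sq_int_def)
    have ae: "AE x in M2. f' x = z * u1 x"
      using ae1(1,2) ae2 by eventually_elim (metis eq_iff_diff_eq_0)
    have ae': "AE x in M2. \<phi> j x = u1 x"
      using ae1(1,3) by eventually_elim (rule trans)
    have "loc_int b M2 (\<lambda>x. z * u1 x)"
      using t by (intro loc_int_cmult S2.sq_int_loc_int) (simp add: triples_iff)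
    moreover have s: "solves u1 u2 f'" "u1 \<in> sq_int M2" using t by (simp_all add: triples_iff)
    ultimately have "solves u1 u2 (\<lambda>x. z * u1 x)"
      using ae by (intro solves_cong_AE[OF s(1)])
    then show ?thesis using s(2) ae' by blast
  qed
  obtain u1 u2 where u: "solves u1 u2 (\<lambda>x. z * u1 x)" "u1 \<in> sq_int M2" "AE x in M2. \<phi> 0 x = u1 x"
    using sol[of 0] by auto
  obtain v1 v2 where v: "solves v1 v2 (\<lambda>x. z * v1 x)" "v1 \<in> sq_int M2" "AE x in M2. \<phi> 1 x = v1 x"
    using sol[of 1] by auto
  have "u1 0 * v2 0 - u2 0 * v1 0 \<noteq> 0"
  proof
    assume W: "u1 0 * v2 0 - u2 0 * v1 0 = 0"
    have "\<exists>p q. (p, q) \<noteq> (0, 0) \<and> p * u1 0 + q * v1 0 = 0 \<and> p * u2 0 + q * v2 0 = 0"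
    proof (cases "u1 0 = 0 \<and> v1 0 = 0")
      case True
      show ?thesis
      proof (cases "u2 0 = 0 \<and> v2 0 = 0")
        case True
        with \<open>u1 0 = 0 \<and> v1 0 = 0\<close> show ?thesis by (intro exI[of _ 1]) auto
      next
        case False
        with True show ?thesis by (intro exI[of _ "v2 0"] exI[of _ "- u2 0"]) auto
      qed
    next
      case False
      with W show ?thesis
        by (intro exI[of _ "v1 0"] exI[of _ "- u1 0"]) (auto simp: algebra_simps)
    qed
    then obtain p q where pq: "(p, q) \<noteq> (0, 0)" "p * u1 0 + q * v1 0 = 0" "p * u2 0 + q * v2 0 = 0"
      by blast
    have "solves (\<lambda>x. p * u1 x + q * v1 x) (\<lambda>x. p * u2 x + q * v2 x) (\<lambda>x. z * (p * u1 x + q * v1 x))"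
      using solves_linear[OF u(1) v(1), of p q] by (simp add: algebra_simps)
    then have zero: "p * u1 x + q * v1 x = 0" if "x \<in> ray b" for x
      using homogeneous_unique[of _ _ z x] pq(2,3) that by blast
    define c where "c i = (if i = (0::nat) then p else q)" for i
    have "AE x in M2. (\<Sum>i<2. c i * \<phi> i x) = 0"
      using u(3) v(3) AE_space
      by eventually_elim (use zero in \<open>simp add: c_def numeral_2_eq_2\<close>)
    then have "cls M2 (\<lambda>x. \<Sum>i<2. c i * \<phi> i x) = cls M2 (\<lambda>_. 0)"
      by (rule cls_eqI)
    then have "c 0 = 0" "c 1 = 0"
      using indep by (auto simp: cls_independent_def)
    then show False using pq(1) by (simp add: c_def)
  qed
  then show ?thesis using u v by (intro that[of u1 u2 z v1 v2])
qed

lemma limit_circle_sq_int: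
  assumes "limit_circle b R1 R2"
  shows "(\<lambda>_. 1) \<in> sq_int M2" "(\<lambda>x. complex_of_real (R1 x)) \<in> sq_int M2"
proof -
  obtain z u1 u2 v1 v2 where *: "solves u1 u2 (\<lambda>x. z * u1 x)" "u1 \<in> sq_int M2"
    "solves v1 v2 (\<lambda>x. z * v1 x)" "v1 \<in> sq_int M2" "u1 0 * v2 0 - u2 0 * v1 0 \<noteq> 0"
    using limit_circle_solutions[OF assms] .
  show "(\<lambda>_. 1) \<in> sq_int M2"
    by (rule sq_int_solution_at_zero[OF * solves_constant])
  show "(\<lambda>x. complex_of_real (R1 x)) \<in> sq_int M2"
    by (rule sq_int_solution_at_zero[OF * solves_R1])
qed

end

section \<open>Uniqueness of the second component\<close>

lemma inner_L2_cong:
  assumes "AE x in N. f x = f' x" "AE x in N. g x = g' x"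
    and "f \<in> sq_int N" "f' \<in> sq_int N" "g \<in> sq_int N" "g' \<in> sq_int N"
  shows "inner_L2 N f g = inner_L2 N f' g'"
  unfolding inner_L2_def
proof (rule integral_cong_AE)
  show "(\<lambda>x. f x * cnj (g x)) \<in> borel_measurable N" "(\<lambda>x. f' x * cnj (g' x)) \<in> borel_measurable N"
    using assms(3-6) sq_int_mult_integrable[OF _ sq_int_cnj] by (auto dest: borel_measurable_integrable)
  show "AE x in N. f x * cnj (g x) = f' x * cnj (g' x)"
    using assms(1,2) by eventually_elim simp
qed

text \<open>The independence of \<open>1\<close> and \<open>R\<^sub>1\<close> is assumed for the measure on the shorter ray, which is the
  restriction of the measure on \<open>[0,b)\<close> because the two agree on half-open intervals.\<close>

lemma (in stieltjes) LS_restrict: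
  assumes b0: "0 < b0" "b0 \<le> b"
  shows "LS b0 R = restrict_space M (ray b0)"
proof -
  have sub: "ray b0 \<subseteq> ray b" using b0(2) by (auto simp: ray_def)
  interpret S0: stieltjes b0 R
  proof
    show "mono_on (ray b0) R" using R_mono sub by (rule mono_on_subset)
  qed (use b0 R_zero R_left_cont sub in auto)
  let ?E = "(\<lambda>(x, y). {x..<y}) ` {(x, y). 0 \<le> x \<and> x \<le> y \<and> ereal y < b0}"
  have ray0: "ray b0 \<in> sets M" using sub ray_borel[of b0] by (simp add: sets_LS_iff)
  obtain c where c: "incseq c" "\<And>n. c n \<in> ray b0" "\<And>x. x \<in> ray b0 \<Longrightarrow> \<exists>n. x < c n"
    using ray_exhaustion[OF b0(1)] by blast
  show ?thesis
  proof (rule measure_eqI_generator_eq[where \<Omega> = "ray b0" and E = ?E and A = "\<lambda>n. {0..<c n}"])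
    show "Int_stable ?E"
    proof (rule Int_stableI_image)
      fix p q :: "real \<times> real"
      assume "p \<in> {(x, y). 0 \<le> x \<and> x \<le> y \<and> ereal y < b0}" "q \<in> {(x, y). 0 \<le> x \<and> x \<le> y \<and> ereal y < b0}"
      then obtain x y x' y' where pq: "p = (x, y)" "0 \<le> x" "x \<le> y" "ereal y < b0"
        "q = (x', y')" "0 \<le> x'" "x' \<le> y'" "ereal y' < b0" by auto
      then have "ereal x < b0" "ereal x' < b0"
        by (meson ereal_less_eq(3) le_less_trans)+
      then show "\<exists>k\<in>{(x, y). 0 \<le> x \<and> x \<le> y \<and> ereal y < b0}.
          (case p of (x, y) \<Rightarrow> {x..<y}) \<inter> (case q of (x, y) \<Rightarrow> {x..<y}) = (case k of (x, y) \<Rightarrow> {x..<y})"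
        using pq by (intro bexI[of _ "(max x x', max (max x x') (min y y'))"])
          (auto simp: max_def min_def)
    qed
    show "?E \<subseteq> Pow (ray b0)" by (rule S0.generators_subset)
    show "emeasure (LS b0 R) X = emeasure (restrict_space M (ray b0)) X" if X: "X \<in> ?E" for X
    proof -
      obtain x y where xy: "X = {x..<y}" "0 \<le> x" "x \<le> y" "ereal y < b0" using X by auto
      then have "y \<in> ray b0" by (auto simp: ray_def)
      then have r: "x \<in> ray b0" "y \<in> ray b0" using xy by (auto intro: ray_downward[of y])
      have "X \<subseteq> ray b0" using X S0.generators_subset by blast
      then have "emeasure (restrict_space M (ray b0)) X = emeasure M X"
        using ray0 sub by (intro emeasure_restrict_space) (auto simp: Int_absorb2)
      then show ?thesis
        using r sub xy by (simp add: emeasure_Ico S0.emeasure_Ico subset_iff)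
    qed
    show "sets (LS b0 R) = sigma_sets (ray b0) ?E" by (rule S0.sets_LS_generated)
    have "sets (restrict_space M (ray b0)) = sets (LS b0 R)"
    proof (rule set_eqI)
      fix A
      have "ray b0 \<inter> space M \<in> sets M" using ray0 sub by (simp add: Int_absorb2)
      then show "A \<in> sets (restrict_space M (ray b0)) \<longleftrightarrow> A \<in> sets (LS b0 R)"
        using sub by (simp only: sets_restrict_space_iff sets_LS_iff S0.sets_LS_iff) auto
    qed
    then show "sets (restrict_space M (ray b0)) = sigma_sets (ray b0) ?E"
      by (simp add: S0.sets_LS_generated)
    show "range (\<lambda>n. {0..<c n}) \<subseteq> ?E"
      using c(2) by (auto simp: ray_def image_iff)
    show "(\<Union>n. {0..<c n}) = ray b0" using c(2,3) by (rule S0.UN_initial)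
    show "emeasure (LS b0 R) {0..<c n} \<noteq> \<infinity>" for n
      using S0.emeasure_initial_finite[OF c(2)[of n]] by simp
  qed
qed

lemma (in stieltjes) AE_LS_restrict:
  assumes "0 < b0" "b0 \<le> b" "AE x in M. P x"
  shows "AE x in LS b0 R. P x"
proof -
  have "ray b0 \<inter> space M = ray b0" using assms(2) by (auto simp: ray_def)
  moreover have "ray b0 \<in> sets M"
    using assms(2) ray_borel[of b0] by (auto simp: sets_LS_iff ray_def)
  ultimately show ?thesis
    using assms(3) unfolding LS_restrict[OF assms(1,2)]
    by (subst AE_restrict_space_iff) auto
qed

context stieltjes_pair
begin

lemma solves_primitive:
  assumes f: "loc_int b M2 f"
  shows "solves (\<lambda>x. p + (LINT t:{0..<x}|M1. q - (LINT s:{0..<t}|M2. f s)))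
    (\<lambda>x. q - (LINT s:{0..<x}|M2. f s)) f"
  using f by (simp add: solves_def set_lebesgue_integral_def)

text \<open>The difference of the two solutions is a combination of \<open>1\<close> and \<open>R\<^sub>1\<close>: its second component is
  a constant, which is the coefficient of \<open>R\<^sub>1\<close> in the first. The first component vanishes almost
  everywhere, and independence makes both coefficients zero.\<close>

lemma second_component_unique:
  assumes u: "solves u1 u2 f" and v: "solves v1 v2 g"
    and eq: "AE x in M2. u1 x = v1 x" "AE x in M2. f x = g x"
    and b0: "0 < b0" "b0 \<le> b"
    and indep: "cls_independent (LS b0 R2) 2 (\<lambda>i x. if i = 0 then 1 else complex_of_real (R1 x))"
    and x: "x \<in> ray b"
  shows "u2 x = v2 x"
proof -
  define d1 where "d1 x = 1 * u1 x + (- 1) * v1 x" for x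
  define d2 where "d2 x = 1 * u2 x + (- 1) * v2 x" for x
  have "solves d1 d2 (\<lambda>x. 1 * f x + (- 1) * g x)"
    unfolding d1_def[abs_def] d2_def[abs_def] by (rule solves_linear[OF u v])
  then have d: "solves d1 d2 (\<lambda>_. 0)"
    using eq(2) by (elim solves_cong_AE) (auto simp: S2.loc_int_const)
  have d2: "d2 x = d2 0" if "x \<in> ray b" for x
    using solvesD(3)[OF d that] by simp
  have d1: "d1 x = d1 0 + complex_of_real (R1 x) * d2 0" if "x \<in> ray b" for x
    using first_component_formula[OF d that] d2[OF that] by simp
  define c where "c i = (if i = (0::nat) then d1 0 else d2 0)" for i
  have "AE x in M2. (\<Sum>i<2. c i * (if i = 0 then 1 else complex_of_real (R1 x))) = 0"
    using eq(1) AE_space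
  proof eventually_elim
    case (elim x)
    then have "d1 x = 0" "x \<in> ray b" by (simp_all add: d1_def)
    then show ?case using d1[of x] by (simp add: c_def numeral_2_eq_2 mult.commute)
  qed
  then have "AE x in LS b0 R2. (\<Sum>i<2. c i * (if i = 0 then 1 else complex_of_real (R1 x))) = 0"
    by (rule S2.AE_LS_restrict[OF b0])
  then have "cls (LS b0 R2) (\<lambda>x. \<Sum>i<2. c i * (if i = 0 then 1 else complex_of_real (R1 x)))
      = cls (LS b0 R2) (\<lambda>_. 0)"
    by (rule cls_eqI)
  then have "c 1 = 0"
    using indep by (auto simp: cls_independent_def)
  then show ?thesis using d2[OF x] by (simp add: c_def d2_def)
qed

end

section \<open>Solutions whose second component vanishes at the end\<close>

text \<open>The consequence of the limit circle property on which the rest depends. In particular \<open>dR\<^sub>2\<close>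
  is a finite measure, and \<open>f\<close> and \<open>f R\<^sub>1\<close> are integrable for every \<open>f \<in> L\<^sup>2(R\<^sub>2)\<close>.\<close>

locale limit_circle_pair = stieltjes_pair +
  assumes one_sq_int: "(\<lambda>_. 1) \<in> sq_int M2"
    and R1_sq_int: "(\<lambda>x. complex_of_real (R1 x)) \<in> sq_int M2"
begin

lemma const_sq_int: "(\<lambda>_. c) \<in> sq_int M2"
  using sq_int_cmult[OF one_sq_int, of c] by simp

lemma sq_int_integrable: "f \<in> sq_int M2 \<Longrightarrow> integrable M2 f"
  using sq_int_mult_integrable[OF _ one_sq_int] by simp

lemma sq_int_R1_integrable: "f \<in> sq_int M2 \<Longrightarrow> integrable M2 (\<lambda>x. f x * complex_of_real (R1 x))"
  using sq_int_mult_integrable[OF _ R1_sq_int] .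

lemma initial_norm_le:
  fixes f :: "real \<Rightarrow> complex"
  assumes "integrable M2 f" "x \<in> ray b"
  shows "norm (LINT t:{0..<x}|M2. f t) \<le> (LINT t|M2. norm (f t))"
proof -
  have "norm (LINT t:{0..<x}|M2. f t) \<le> (LINT t:{0..<x}|M2. norm (f t))"
    by (rule S2.primitive_norm_le[OF S2.integrable_loc_int[OF assms(1)] assms(2)])
  also have "\<dots> \<le> (LINT t|M2. norm (f t))"
    unfolding set_lebesgue_integral_def using assms
    by (intro integral_mono integrable_mult_indicator) (auto split: split_indicator)
  finally show ?thesis .
qed

text \<open>By \<open>first_component_formula\<close>, \<open>|u\<^sub>1| \<le> A + B R\<^sub>1\<close> with constants \<open>A\<close> and \<open>B\<close>.\<close>

lemma solves_sq_int:
  assumes u: "solves u1 u2 f" and f: "f \<in> sq_int M2"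
  shows "u1 \<in> sq_int M2"
proof -
  define A where "A = cmod (u1 0) + (LINT t|M2. cmod (f t * complex_of_real (R1 t)))"
  define B where "B = cmod (u2 0) + (LINT t|M2. cmod (f t))"
  have bound: "(\<lambda>x. complex_of_real A + complex_of_real B * complex_of_real (R1 x)) \<in> sq_int M2"
    by (intro sq_int_add const_sq_int sq_int_cmult R1_sq_int)
  show ?thesis
  proof (rule sq_int_bound[OF _ bound])
    show "u1 \<in> borel_measurable M2" using solves_regularity(1)[OF u S2.sets_LS] .
    show "AE x in M2. cmod (u1 x) \<le> cmod (complex_of_real A + complex_of_real B * complex_of_real (R1 x))"
    proof (rule AE_I2)
      fix x assume "x \<in> space M2"
      then have x: "x \<in> ray b" by simp
      have "cmod (u2 x) \<le> B"
        using norm_triangle_ineq4[of "u2 0" "LINT t:{0..<x}|M2. f t"]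
          initial_norm_le[OF sq_int_integrable[OF f] x] solvesD(3)[OF u x] by (simp add: B_def)
      then have "cmod (complex_of_real (R1 x) * u2 x) \<le> R1 x * B"
        using S1.R_nonneg[OF x] by (auto simp: norm_mult intro: mult_left_mono)
      moreover have "cmod (u1 x) \<le> cmod (u1 0) + cmod (complex_of_real (R1 x) * u2 x)
          + cmod (LINT t:{0..<x}|M2. f t * complex_of_real (R1 t))"
        unfolding first_component_formula[OF u x]
        by (meson norm_triangle_ineq norm_triangle_mono order_refl)
      moreover note initial_norm_le[OF sq_int_R1_integrable[OF f] x]
      ultimately have "cmod (u1 x) \<le> A + B * R1 x"
        by (simp add: A_def mult.commute)
      also have "\<dots> \<le> cmod (complex_of_real (A + B * R1 x))" by (simp only: norm_of_real abs_ge_self)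
      finally show "cmod (u1 x) \<le> cmod (complex_of_real A + complex_of_real B * complex_of_real (R1 x))"
        by simp
    qed
  qed
qed

lemma second_component_tendsto:
  assumes u: "solves u1 u2 f" and f: "f \<in> sq_int M2"
  shows "(u2 \<longlongrightarrow> u2 0 - (LINT t|M2. f t)) (at_end b)"
proof (rule Lim_transform_eventually)
  show "((\<lambda>x. u2 0 - (LINT t:{0..<x}|M2. f t)) \<longlongrightarrow> u2 0 - (LINT t|M2. f t)) (at_end b)"
    by (intro tendsto_intros S2.primitive_tendsto sq_int_integrable f)
  show "\<forall>\<^sub>F x in at_end b. u2 0 - (LINT t:{0..<x}|M2. f t) = u2 x"
    using eventually_in_ray[OF b_pos] by eventually_elim (simp add: solvesD(3)[OF u])
qed

text \<open>On \<open>[x,b)\<close> the monotone \<open>R\<^sub>1\<close> is at least \<open>R\<^sub>1(x)\<close>, so this factor can be moved under the tail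
  integral. The tail is written as a difference, here and below, because primitives run over initial
  intervals.\<close>

lemma R1_tail_bound:
  assumes f: "f \<in> sq_int M2" and x: "x \<in> ray b"
  shows "cmod (complex_of_real (R1 x) * ((LINT t|M2. f t) - (LINT t:{0..<x}|M2. f t)))
    \<le> (LINT t|M2. cmod (f t * complex_of_real (R1 t))) - (LINT t:{0..<x}|M2. cmod (f t * complex_of_real (R1 t)))"
proof -
  note fi = sq_int_integrable[OF f] and fR = sq_int_R1_integrable[OF f]
  note x2 = S2.sets_initial[OF x]
  have fRn: "integrable M2 (\<lambda>t. cmod (f t * complex_of_real (R1 t)))" using fR by (rule integrable_norm)
  have i1: "integrable M2 (\<lambda>t. indicator {0..<x} t *\<^sub>R f t)"
    using x2 fi by (rule integrable_mult_indicator)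
  have i2: "integrable M2 (\<lambda>t. indicator {0..<x} t *\<^sub>R cmod (f t * complex_of_real (R1 t)))"
    using x2 fRn by (rule integrable_mult_indicator)
  have "complex_of_real (R1 x) * ((LINT t|M2. f t) - (LINT t:{0..<x}|M2. f t))
      = (LINT t|M2. complex_of_real (R1 x) * (f t - indicator {0..<x} t *\<^sub>R f t))"
    unfolding set_lebesgue_integral_def using fi i1 by simp
  also have "cmod \<dots> \<le> (LINT t|M2. cmod (complex_of_real (R1 x) * (f t - indicator {0..<x} t *\<^sub>R f t)))"
    by (rule integral_norm_bound)
  also have "\<dots> \<le> (LINT t|M2. cmod (f t * complex_of_real (R1 t))
      - indicator {0..<x} t *\<^sub>R cmod (f t * complex_of_real (R1 t)))"
  proof (rule integral_mono)
    show "integrable M2 (\<lambda>t. cmod (complex_of_real (R1 x) * (f t - indicator {0..<x} t *\<^sub>R f t)))"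
      using fi i1 by (intro integrable_norm integrable_mult_right Bochner_Integration.integrable_diff) auto
    show "integrable M2 (\<lambda>t. cmod (f t * complex_of_real (R1 t))
        - indicator {0..<x} t *\<^sub>R cmod (f t * complex_of_real (R1 t)))"
      using fRn i2 by (rule Bochner_Integration.integrable_diff)
    fix t assume t: "t \<in> space M2"
    show "cmod (complex_of_real (R1 x) * (f t - indicator {0..<x} t *\<^sub>R f t))
        \<le> cmod (f t * complex_of_real (R1 t)) - indicator {0..<x} t *\<^sub>R cmod (f t * complex_of_real (R1 t))"
    proof (cases "t < x")
      case True
      then show ?thesis using t by (simp add: ray_def)
    next
      case False
      then have "R1 x \<le> R1 t" using mono_onD[OF S1.R_mono x] t by simp
      then show ?thesis
        using False S1.R_nonneg[OF x] S1.R_nonneg[of t] t by (simp add: norm_mult mult.commute mult_right_mono)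
    qed
  qed
  also have "\<dots> = (LINT t|M2. cmod (f t * complex_of_real (R1 t)))
      - (LINT t:{0..<x}|M2. cmod (f t * complex_of_real (R1 t)))"
    unfolding set_lebesgue_integral_def using fRn i2 by (rule Bochner_Integration.integral_diff)
  finally show ?thesis .
qed

lemma second_component_eq_tail:
  assumes u: "solves u1 u2 f" and f: "f \<in> sq_int M2" and lim: "(u2 \<longlongrightarrow> 0) (at_end b)"
  shows "u2 0 = (LINT t|M2. f t)"
    and "x \<in> ray b \<Longrightarrow> u2 x = (LINT t|M2. f t) - (LINT t:{0..<x}|M2. f t)"
proof -
  show *: "u2 0 = (LINT t|M2. f t)"
    using tendsto_unique[OF at_end_neq_bot[OF b_pos] second_component_tendsto[OF u f] lim] by simp
  show "u2 x = (LINT t|M2. f t) - (LINT t:{0..<x}|M2. f t)" if "x \<in> ray b"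
    using solvesD(3)[OF u that] * by simp
qed

text \<open>In \<open>first_component_formula\<close> the term \<open>R\<^sub>1 u\<^sub>2\<close> is dominated by a tail of a convergent integral.\<close>

lemma first_component_tendsto:
  assumes u: "solves u1 u2 f" and f: "f \<in> sq_int M2" and lim: "(u2 \<longlongrightarrow> 0) (at_end b)"
  shows "(u1 \<longlongrightarrow> u1 0 + (LINT t|M2. f t * complex_of_real (R1 t))) (at_end b)"
proof -
  have "((\<lambda>x. (LINT t|M2. cmod (f t * complex_of_real (R1 t)))
      - (LINT t:{0..<x}|M2. cmod (f t * complex_of_real (R1 t)))) \<longlongrightarrow>
      (LINT t|M2. cmod (f t * complex_of_real (R1 t))) - (LINT t|M2. cmod (f t * complex_of_real (R1 t)))) (at_end b)"
    using sq_int_R1_integrable[OF f] by (intro tendsto_intros S2.primitive_tendsto integrable_norm)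
  then have null: "((\<lambda>x. (LINT t|M2. cmod (f t * complex_of_real (R1 t)))
      - (LINT t:{0..<x}|M2. cmod (f t * complex_of_real (R1 t)))) \<longlongrightarrow> 0) (at_end b)"
    by (simp only: diff_self)
  have zero: "((\<lambda>x. complex_of_real (R1 x) * u2 x) \<longlongrightarrow> 0) (at_end b)"
  proof (rule Lim_null_comparison[OF _ null])
    show "\<forall>\<^sub>F x in at_end b. norm (complex_of_real (R1 x) * u2 x)
      \<le> (LINT t|M2. cmod (f t * complex_of_real (R1 t)))
      - (LINT t:{0..<x}|M2. cmod (f t * complex_of_real (R1 t)))"
      using eventually_in_ray[OF b_pos]
    proof eventually_elim
      case (elim x)
      then show ?case using R1_tail_bound[OF f elim] second_component_eq_tail(2)[OF u f lim elim] by simp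
    qed
  qed
  have "((\<lambda>x. u1 0 + complex_of_real (R1 x) * u2 x + (LINT t:{0..<x}|M2. f t * complex_of_real (R1 t)))
      \<longlongrightarrow> u1 0 + 0 + (LINT t|M2. f t * complex_of_real (R1 t))) (at_end b)"
    using zero sq_int_R1_integrable[OF f] by (intro tendsto_intros S2.primitive_tendsto)
  then have "(u1 \<longlongrightarrow> u1 0 + 0 + (LINT t|M2. f t * complex_of_real (R1 t))) (at_end b)"
  proof (rule Lim_transform_eventually)
    show "\<forall>\<^sub>F x in at_end b. u1 0 + complex_of_real (R1 x) * u2 x
        + (LINT t:{0..<x}|M2. f t * complex_of_real (R1 t)) = u1 x"
      using eventually_in_ray[OF b_pos] by eventually_elim (simp add: first_component_formula[OF u])
  qed
  then show ?thesis by simp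
qed

text \<open>Let \<open>v(x)\<close> be the integral of \<open>|f|\<close> over \<open>[x,b)\<close>, so that \<open>|u\<^sub>2|\<^sup>2 \<le> v\<^sup>2 \<le> v(0) v\<close>. The function
  \<open>v\<close> is itself the second component of a solution, with right-hand side \<open>|f|\<close>, and
  \<open>first_component_formula\<close> for it bounds \<open>\<integral> v dR\<^sub>1\<close> by \<open>\<integral> |f| R\<^sub>1 dR\<^sub>2\<close>.\<close>

lemma second_component_sq_int:
  assumes u: "solves u1 u2 f" and f: "f \<in> sq_int M2" and lim: "(u2 \<longlongrightarrow> 0) (at_end b)"
  shows "u2 \<in> sq_int M1"
proof -
  define F where "F = (LINT t|M2. cmod (f t))"
  define v where "v x = F - (LINT t:{0..<x}|M2. cmod (f t))" for x
  define g where "g t = complex_of_real (cmod (f t))" for t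
  have fi: "integrable M2 (\<lambda>t. cmod (f t))" using sq_int_integrable[OF f] by simp
  have g: "g \<in> sq_int M2" using f by (auto simp: sq_int_def g_def[abs_def])
  have vg: "complex_of_real (v x) = complex_of_real F - (LINT t:{0..<x}|M2. g t)" for x
    by (simp add: v_def g_def set_integral_complex_of_real)
  have gF: "(LINT t|M2. g t) = complex_of_real F" by (simp add: g_def F_def)
  define V1 where "V1 x = 0 + (LINT t:{0..<x}|M1. complex_of_real F - (LINT s:{0..<t}|M2. g s))" for x
  have V: "solves V1 (\<lambda>x. complex_of_real F - (LINT s:{0..<x}|M2. g s)) g"
    unfolding V1_def[abs_def] by (rule solves_primitive[OF S2.sq_int_loc_int[OF g]])
  have V': "solves V1 (\<lambda>x. complex_of_real (v x)) g"
    using V by (simp add: vg)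
  have u2_le: "cmod (u2 x) \<le> v x" if x: "x \<in> ray b" for x
  proof -
    have i: "integrable M2 (\<lambda>t. indicator {0..<x} t *\<^sub>R f t)" "integrable M2 (\<lambda>t. indicator {0..<x} t *\<^sub>R cmod (f t))"
      by (intro integrable_mult_indicator S2.sets_initial[OF x] sq_int_integrable[OF f] fi)+
    have "u2 x = (LINT t|M2. f t - indicator {0..<x} t *\<^sub>R f t)"
      using second_component_eq_tail(2)[OF u f lim x] sq_int_integrable[OF f] i
      by (simp add: set_lebesgue_integral_def)
    also have "cmod \<dots> \<le> (LINT t|M2. cmod (f t - indicator {0..<x} t *\<^sub>R f t))"
      by (rule integral_norm_bound)
    also have "\<dots> = (LINT t|M2. cmod (f t) - indicator {0..<x} t *\<^sub>R cmod (f t))"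
      by (intro Bochner_Integration.integral_cong) (auto split: split_indicator)
    also have "\<dots> = v x"
      using fi i by (simp add: v_def F_def set_lebesgue_integral_def)
    finally show ?thesis .
  qed
  have v_le: "v x \<le> F" for x
    using S2.primitive_nonneg[of "\<lambda>t. cmod (f t)" x] by (simp add: v_def)
  have F0: "0 \<le> F" by (simp add: F_def)
  have v0: "0 \<le> v x" if "x \<in> ray b" for x
    using u2_le[OF that] norm_ge_zero order.trans by blast
  have vm [measurable]: "v \<in> borel_measurable M1"
    unfolding v_def[abs_def]
    using S2.primitive_measurable[OF borel_measurable_integrable[OF fi] S1.sets_LS] by measurable
  have v_loc: "loc_int b M1 v"
    using vm by (rule S1.loc_int_bounded) (use v0 v_le ray_downward in \<open>force simp: loc_bdd_def intro!: exI[of _ F]\<close>)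
  have "integrable M1 v"
  proof (rule S1.integrable_if_primitive_bounded[OF v_loc v0])
    fix x assume x: "x \<in> ray b"
    let ?I = "LINT t:{0..<x}|M2. cmod (g t * complex_of_real (R1 t))"
    have nn: "0 \<le> (LINT t:{0..<x}|M1. v t)" using v0 by (rule S1.primitive_nonneg)
    have "complex_of_real (LINT t:{0..<x}|M1. v t) = V1 x"
      by (simp add: V1_def flip: vg set_integral_complex_of_real)
    then have "(LINT t:{0..<x}|M1. v t) = cmod (V1 x)"
      using nn by (metis abs_of_nonneg norm_of_real)
    also have "V1 x = complex_of_real (R1 x) * (complex_of_real F - (LINT s:{0..<x}|M2. g s))
        + (LINT t:{0..<x}|M2. g t * complex_of_real (R1 t))"
      using first_component_formula[OF V x] by (simp add: V1_def set_lebesgue_integral_def)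
    also have "cmod \<dots> \<le> cmod (complex_of_real (R1 x) * (complex_of_real F - (LINT s:{0..<x}|M2. g s)))
        + cmod (LINT t:{0..<x}|M2. g t * complex_of_real (R1 t))"
      by (rule norm_triangle_ineq)
    also have "\<dots> \<le> ((LINT t|M2. cmod (g t * complex_of_real (R1 t))) - ?I) + ?I"
      using R1_tail_bound[OF g x] S2.primitive_norm_le[OF S2.integrable_loc_int[OF sq_int_R1_integrable[OF g]] x]
      unfolding gF by (rule add_mono)
    finally show "(LINT t:{0..<x}|M1. v t) \<le> (LINT t|M2. cmod (g t * complex_of_real (R1 t)))"
      by simp
  qed
  then have "integrable M1 (\<lambda>t. F * v t)" by simp
  then have "integrable M1 (\<lambda>t. (cmod (u2 t))\<^sup>2)"
  proof (rule Bochner_Integration.integrable_bound)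
    show "(\<lambda>t. (cmod (u2 t))\<^sup>2) \<in> borel_measurable M1"
      using solves_regularity(2)[OF u S1.sets_LS] by measurable
    show "AE t in M1. norm ((cmod (u2 t))\<^sup>2) \<le> norm (F * v t)"
    proof (rule AE_I2)
      fix t assume "t \<in> space M1"
      then have t: "t \<in> ray b" by simp
      have "(cmod (u2 t))\<^sup>2 \<le> F * v t"
        unfolding power2_eq_square using u2_le[OF t] v_le[of t] F0 by (intro mult_mono) auto
      then show "norm ((cmod (u2 t))\<^sup>2) \<le> norm (F * v t)" by simp
    qed
  qed
  then show ?thesis
    using solves_regularity(2)[OF u S1.sets_LS] by (simp add: sq_int_def)
qed

section \<open>The adjoint relation\<close>

text \<open>In the limit \<open>x \<rightarrow> b\<close> the boundary term \<open>u\<^sub>1 cnj v\<^sub>2 - u\<^sub>2 cnj v\<^sub>1\<close> of the Lagrange identity vanishes,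
  because \<open>u\<^sub>1\<close> and \<open>v\<^sub>1\<close> have finite limits.\<close>

lemma neumann_symmetric:
  assumes u: "solves u1 u2 f" and f: "f \<in> sq_int M2" and ulim: "(u2 \<longlongrightarrow> 0) (at_end b)"
    and v: "solves v1 v2 g" and g: "g \<in> sq_int M2" and vlim: "(v2 \<longlongrightarrow> 0) (at_end b)"
    and init: "u1 0 = 0" "u2 0 = 0"
  shows "inner_L2 M2 f v1 = inner_L2 M2 u1 g"
proof -
  have fv: "integrable M2 (\<lambda>t. f t * cnj (v1 t))" and ug: "integrable M2 (\<lambda>t. u1 t * cnj (g t))"
    using sq_int_mult_integrable[OF f sq_int_cnj[OF solves_sq_int[OF v g]]]
      sq_int_mult_integrable[OF solves_sq_int[OF u f] sq_int_cnj[OF g]] .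
  let ?I = "\<lambda>t. f t * cnj (v1 t) - u1 t * cnj (g t)"
  have lim1: "((\<lambda>x. LINT t:{0..<x}|M2. ?I t) \<longlongrightarrow> (LINT t|M2. ?I t)) (at_end b)"
    using fv ug by (intro S2.primitive_tendsto) auto
  have "((\<lambda>x. u1 x * cnj (v2 x) - u2 x * cnj (v1 x)) \<longlongrightarrow>
      (u1 0 + (LINT t|M2. f t * complex_of_real (R1 t))) * cnj 0
      - 0 * cnj (v1 0 + (LINT t|M2. g t * complex_of_real (R1 t)))) (at_end b)"
    by (intro tendsto_intros first_component_tendsto[OF u f ulim] first_component_tendsto[OF v g vlim] ulim vlim)
  then have "((\<lambda>x. u1 x * cnj (v2 x) - u2 x * cnj (v1 x)) \<longlongrightarrow> 0) (at_end b)" by simp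
  then have "((\<lambda>x. LINT t:{0..<x}|M2. ?I t) \<longlongrightarrow> 0) (at_end b)"
  proof (rule Lim_transform_eventually)
    show "\<forall>\<^sub>F x in at_end b. u1 x * cnj (v2 x) - u2 x * cnj (v1 x) = (LINT t:{0..<x}|M2. ?I t)"
      using eventually_in_ray[OF b_pos]
      by eventually_elim (use lagrange_identity[OF u solves_cnj[OF v]] init in simp)
  qed
  then have "(LINT t|M2. ?I t) = 0"
    using tendsto_unique[OF at_end_neq_bot[OF b_pos] lim1] by blast
  then show ?thesis using fv ug by (simp add: inner_L2_def)
qed

lemma neumann_in_adjoint:
  assumes u: "solves u1 u2 f" and f: "f \<in> sq_int M2" and lim: "(u2 \<longlongrightarrow> 0) (at_end b)"
  shows "(cls M2 u1, cls M2 f) \<in> T_N_adjoint b R1 R2"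
  unfolding rel_adjoint_def
proof (intro CollectI exI conjI ballI impI)
  show u1: "u1 \<in> sq_int M2" using u f by (rule solves_sq_int)
  fix v g assume v: "v \<in> sq_int M2" and g: "g \<in> sq_int M2" and "(cls M2 v, cls M2 g) \<in> T_N b R1 R2"
  then obtain w1 w2 h where w: "(w1, w2, h) \<in> triples b R1 R2" "w1 0 = 0" "w2 0 = 0" "(w2 \<longlongrightarrow> 0) (at_end b)"
    and eq: "cls M2 v = cls M2 w1" "cls M2 g = cls M2 h"
    by (auto simp: T_N_def)
  have w': "w1 \<in> sq_int M2" "h \<in> sq_int M2" "solves w1 w2 h"
    using w(1) by (simp_all add: triples_iff)
  have "inner_L2 M2 g u1 = inner_L2 M2 h u1"
    using cls_eqD[OF eq(2) g] g w' u1 by (intro inner_L2_cong) auto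
  also have "\<dots> = inner_L2 M2 w1 f"
    by (rule neumann_symmetric[OF w'(3,2) w(4) u f lim w(2,3)])
  also have "\<dots> = inner_L2 M2 v f"
  proof (rule inner_L2_cong)
    show "AE x in M2. w1 x = v x" using cls_eqD[OF eq(1) v] by eventually_elim simp
  qed (use v w' f in auto)
  finally show "inner_L2 M2 g u1 = inner_L2 M2 v f" .
qed (use f in auto)

text \<open>Subtracting the mean works for positive total mass; if the mass is zero, every integral vanishes.\<close>

lemma integral_zero_mean:
  assumes w: "w \<in> sq_int M2"
  obtains c where "(LINT t|M2. w t - c) = 0"
proof (cases "measure M2 (space M2) = 0")
  case True
  have "integrable M2 (\<lambda>_. 1 :: real)"
    using one_sq_int by (simp add: sq_int_def)
  moreover have "(LINT t|M2. (1::real)) = 0" using True by simp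
  ultimately have "AE t in M2. (1::real) = 0"
    using integral_nonneg_eq_0_iff_AE[of M2 "\<lambda>_. 1"] by simp
  then have "(LINT t|M2. w t - 0) = 0"
    by (intro integral_eq_zero_AE) auto
  then show ?thesis by (rule that)
next
  case False
  let ?c = "(LINT t|M2. w t) / complex_of_real (measure M2 (space M2))"
  have "(LINT t|M2. w t - ?c) = 0"
    using sq_int_integrable[OF w] sq_int_integrable[OF const_sq_int[of ?c]] False
    by (simp add: scaleR_conv_of_real)
  then show ?thesis by (rule that)
qed

text \<open>With \<open>h\<close> the solution for the right-hand side \<open>g\<close> that satisfies \<open>h\<^sub>2(b) = 0\<close>, let \<open>f\<close> be \<open>v - h\<^sub>1\<close> minus its
  mean. Since \<open>f\<close> has mean zero, it is the right-hand side of an element of \<open>T\<^sub>N\<close>. Testing the adjoint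
  condition with this element shows that \<open>f\<close> is orthogonal to \<open>v - h\<^sub>1\<close> and thus to itself,
  so \<open>v = h\<^sub>1 + c\<close> almost everywhere.\<close>

lemma adjoint_is_neumann:
  assumes "U \<in> T_N_adjoint b R1 R2"
  obtains h1 h2 g where "(h1, h2, g) \<in> triples b R1 R2" "U = (cls M2 h1, cls M2 g)" "(h2 \<longlongrightarrow> 0) (at_end b)"
proof -
  obtain v g where U: "U = (cls M2 v, cls M2 g)" and v: "v \<in> sq_int M2" and g: "g \<in> sq_int M2"
    and adj: "\<And>u f. u \<in> sq_int M2 \<Longrightarrow> f \<in> sq_int M2 \<Longrightarrow> (cls M2 u, cls M2 f) \<in> T_N b R1 R2
      \<Longrightarrow> inner_L2 M2 f v = inner_L2 M2 u g"
    using assms by (auto simp: rel_adjoint_def)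
  \<comment> \<open>The initial value \<open>h2 0\<close> is the full integral of \<open>g\<close>, which makes \<open>h2\<close> vanish at \<open>b\<close>.\<close>
  define h2 where "h2 x = (LINT t|M2. g t) - (LINT t:{0..<x}|M2. g t)" for x
  define h1 where "h1 x = 0 + (LINT t:{0..<x}|M1. (LINT t|M2. g t) - (LINT s:{0..<t}|M2. g s))" for x
  have h: "solves h1 h2 g"
    unfolding h1_def[abs_def] h2_def[abs_def] by (rule solves_primitive[OF S2.sq_int_loc_int[OF g]])
  have h2_lim: "(h2 \<longlongrightarrow> 0) (at_end b)"
    using second_component_tendsto[OF h g] by (simp add: h2_def set_lebesgue_integral_def)
  have h1: "h1 \<in> sq_int M2" using h g by (rule solves_sq_int)
  define w where "w x = v x - h1 x" for x
  have w: "w \<in> sq_int M2" unfolding w_def[abs_def] using v h1 by (rule sq_int_diff)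
  obtain c where c: "(LINT t|M2. w t - c) = 0" using integral_zero_mean[OF w] .
  define f where "f x = w x - c" for x
  have f: "f \<in> sq_int M2" unfolding f_def[abs_def] using w const_sq_int by (rule sq_int_diff)
  define s2 where "s2 x = 0 - (LINT t:{0..<x}|M2. f t)" for x
  define s1 where "s1 x = 0 + (LINT t:{0..<x}|M1. 0 - (LINT s:{0..<t}|M2. f s))" for x
  have s: "solves s1 s2 f"
    unfolding s1_def[abs_def] s2_def[abs_def] by (rule solves_primitive[OF S2.sq_int_loc_int[OF f]])
  have s0: "s1 0 = 0" "s2 0 = 0" by (simp_all add: s1_def s2_def set_lebesgue_integral_def)
  have s2_lim: "(s2 \<longlongrightarrow> 0) (at_end b)"
    using second_component_tendsto[OF s f] c s0 by (simp add: f_def)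
  have s1: "s1 \<in> sq_int M2" using s f by (rule solves_sq_int)
  have "(cls M2 s1, cls M2 f) \<in> T_N b R1 R2"
    unfolding T_N_def using s s0 s1 f s2_lim by (auto simp: triples_iff)
  then have "inner_L2 M2 f v = inner_L2 M2 s1 g" using s1 f by (intro adj)
  also have "\<dots> = inner_L2 M2 f h1"
    by (rule neumann_symmetric[OF s f s2_lim h g h2_lim s0, symmetric])
  finally have fvh: "inner_L2 M2 f v = inner_L2 M2 f h1" .
  have "complex_of_real (LINT t|M2. (cmod (f t))\<^sup>2) = (LINT t|M2. f t * cnj (f t))"
    by (simp add: complex_norm_square[symmetric] flip: of_real_power)
  also have "\<dots> = (LINT t|M2. f t * cnj (v t) - f t * cnj (h1 t) - f t * cnj c)"
    by (simp add: f_def w_def algebra_simps)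
  also have "\<dots> = inner_L2 M2 f v - inner_L2 M2 f h1 - (LINT t|M2. f t) * cnj c"
    using sq_int_mult_integrable[OF f sq_int_cnj[OF v]] sq_int_mult_integrable[OF f sq_int_cnj[OF h1]]
      sq_int_integrable[OF f] by (simp add: inner_L2_def)
  also have "\<dots> = 0" using fvh c by (simp add: f_def)
  finally have "(LINT t|M2. (cmod (f t))\<^sup>2) = 0" by simp
  then have "AE t in M2. (cmod (f t))\<^sup>2 = 0"
    using f by (subst (asm) integral_nonneg_eq_0_iff_AE) (auto simp: sq_int_def)
  then have eq: "AE t in M2. v t = 1 * h1 t + c * 1"
    by eventually_elim (simp add: f_def w_def diff_eq_eq add.commute)
  have "solves (\<lambda>x. 1 * h1 x + c * 1) h2 g"
    using solves_linear[OF h solves_constant, of 1 c] by simp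
  then have "((\<lambda>x. 1 * h1 x + c * 1), h2, g) \<in> triples b R1 R2"
    using g by (auto simp: triples_iff intro: solves_sq_int)
  then show ?thesis
    using U cls_eqI[OF eq] h2_lim by (intro that) auto
qed

section \<open>Singular end points and the theorem\<close>

lemma R_end_finite:
  assumes "(R \<longlongrightarrow> l) (at_end b)"
  shows "R_end b R < \<infinity>"
  unfolding R_end_def
  using tendsto_Lim[OF at_end_neq_bot[OF b_pos] tendsto_ennrealI[OF assms]] by simp

text \<open>If \<open>u\<^sub>2\<close> had a nonzero limit, then \<open>u\<^sub>1 \<rightarrow> 0\<close>, and \<open>first_component_formula\<close> divided by \<open>u\<^sub>2\<close> would
  exhibit \<open>R\<^sub>1\<close> as convergent. The total mass of \<open>dR\<^sub>2\<close> is finite as well, so \<open>b\<close> would be regular.\<close>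

lemma singular_neumann:
  assumes sing: "singular_at_end b R1 R2" and u: "solves u1 u2 f" and f: "f \<in> sq_int M2"
    and prod: "((\<lambda>x. u1 x * u2 x) \<longlongrightarrow> 0) (at_end b)"
  shows "(u2 \<longlongrightarrow> 0) (at_end b)"
proof -
  define L where "L = u2 0 - (LINT t|M2. f t)"
  have u2: "(u2 \<longlongrightarrow> L) (at_end b)" unfolding L_def using u f by (rule second_component_tendsto)
  have "L = 0"
  proof (rule ccontr)
    assume L: "L \<noteq> 0"
    have nz: "\<forall>\<^sub>F x in at_end b. u2 x \<noteq> 0" using u2 L by (rule tendsto_imp_eventually_ne)
    have "((\<lambda>x. u1 x * u2 x / u2 x) \<longlongrightarrow> 0 / L) (at_end b)"
      using prod u2 L by (rule tendsto_divide)
    then have u1: "(u1 \<longlongrightarrow> 0 / L) (at_end b)"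
      by (rule Lim_transform_eventually) (use nz in eventually_elim, simp)
    define l where "l = (0 / L - u1 0 - (LINT t|M2. f t * complex_of_real (R1 t))) / L"
    have "((\<lambda>x. (u1 x - u1 0 - (LINT t:{0..<x}|M2. f t * complex_of_real (R1 t))) / u2 x) \<longlongrightarrow> l) (at_end b)"
      unfolding l_def using u1 u2 L
      by (intro tendsto_intros S2.primitive_tendsto sq_int_R1_integrable f)
    then have "((\<lambda>x. complex_of_real (R1 x)) \<longlongrightarrow> l) (at_end b)"
    proof (rule Lim_transform_eventually)
      show "\<forall>\<^sub>F x in at_end b. (u1 x - u1 0 - (LINT t:{0..<x}|M2. f t * complex_of_real (R1 t))) / u2 x
          = complex_of_real (R1 x)"
        using nz eventually_in_ray[OF b_pos]
      proof eventually_elim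
        case (elim x)
        then show ?case using first_component_formula[OF u elim(2)] by (simp add: field_simps)
      qed
    qed
    then have "(R1 \<longlongrightarrow> Re l) (at_end b)" using tendsto_Re by fastforce
    then have 1: "R_end b R1 < \<infinity>" by (rule R_end_finite)
    have "((\<lambda>x. LINT t:{0..<x}|M2. (1::real)) \<longlongrightarrow> (LINT t|M2. 1)) (at_end b)"
      using one_sq_int by (intro S2.primitive_tendsto) (simp add: sq_int_def)
    then have "(R2 \<longlongrightarrow> (LINT t|M2. 1)) (at_end b)"
    proof (rule Lim_transform_eventually)
      show "\<forall>\<^sub>F x in at_end b. (LINT t:{0..<x}|M2. (1::real)) = R2 x"
        using eventually_in_ray[OF b_pos]
      proof eventually_elim
        case (elim x)
        then show ?case
          using S2.sets_initial[OF elim] S2.emeasure_initial_finite[OF elim]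
          by (simp add: set_integral_const S2.measure_initial)
      qed
    qed
    then have 2: "R_end b R2 < \<infinity>" by (rule R_end_finite)
    show False using sing 1 2 by (simp add: regular_at_end_def)
  qed
  then show ?thesis using u2 by simp
qed

end

theorem lemma3p3:
  fixes b :: ereal and R1 R2 :: "real \<Rightarrow> real"
  assumes "integral_system b R1 R2"
    and "standing_assumptions b R1 R2"
    and "limit_circle b R1 R2"
  shows "(\<forall>U \<in> T_N_adjoint b R1 R2. U \<in> T_max b R1 R2 \<and>
            (\<forall>u1 u2 f. (u1, u2, f) \<in> triples b R1 R2 \<and> U = (cls (LS b R2) u1, cls (LS b R2) f) \<longrightarrow>
               u2 \<in> sq_int (LS b R1) \<and>
               set_integrable (LS b R2) (ray b) (\<lambda>x. f x * complex_of_real (R1 x)) \<and>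
               (u1 \<longlongrightarrow> u1 0 + (LINT x:ray b|LS b R2. f x * complex_of_real (R1 x))) (at_end b) \<and>
               ((\<lambda>x. u1 x * u2 x) \<longlongrightarrow> 0) (at_end b))) \<and>
         (\<forall>u1 u2 f. (u1, u2, f) \<in> triples b R1 R2 \<and> singular_at_end b R1 R2 \<and>
            ((\<lambda>x. u1 x * u2 x) \<longlongrightarrow> 0) (at_end b) \<longrightarrow>
            (cls (LS b R2) u1, cls (LS b R2) f) \<in> T_N_adjoint b R1 R2)"
proof -
  interpret stieltjes_pair b R1 R2
    using assms(1,2) by unfold_locales (auto simp: integral_system_def standing_assumptions_def)
  interpret limit_circle_pair b R1 R2
    using limit_circle_sq_int[OF assms(3)] by unfold_locales
  obtain b0 where b0: "0 < b0" "b0 \<le> b"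
    and indep: "cls_independent (LS b0 R2) 2 (\<lambda>i x. if i = 0 then 1 else complex_of_real (R1 x))"
    using assms(2) by (auto simp: standing_assumptions_def)
  show ?thesis
  proof (intro conjI ballI allI impI; (elim conjE)?)
    fix U assume U: "U \<in> T_N_adjoint b R1 R2"
    obtain h1 h2 g where h: "(h1, h2, g) \<in> triples b R1 R2" "U = (cls M2 h1, cls M2 g)" "(h2 \<longlongrightarrow> 0) (at_end b)"
      using adjoint_is_neumann[OF U] .
    then show "U \<in> T_max b R1 R2" by (auto simp: T_max_def)
    fix u1 u2 f assume t: "(u1, u2, f) \<in> triples b R1 R2" and Uu: "U = (cls M2 u1, cls M2 f)"
    have u: "solves u1 u2 f" and f: "f \<in> sq_int M2" and u1: "u1 \<in> sq_int M2"
      using t by (simp_all add: triples_iff)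
    have hs: "solves h1 h2 g" using h(1) by (simp add: triples_iff)
    have "AE x in M2. u1 x = h1 x" "AE x in M2. f x = g x"
      using Uu h(2) cls_eqD[OF _ u1, of h1] cls_eqD[OF _ f, of g] by auto
    \<comment> \<open>The element \<open>U\<close> determines the second component, so the given triple inherits the boundary
      condition from \<open>h2\<close>.\<close>
    then have "u2 x = h2 x" if "x \<in> ray b" for x
      using second_component_unique[OF u hs _ _ b0 indep that] by blast
    then have "\<forall>\<^sub>F x in at_end b. h2 x = u2 x"
      using eventually_in_ray[OF b_pos] by (auto elim: eventually_mono)
    then have lim: "(u2 \<longlongrightarrow> 0) (at_end b)" by (rule Lim_transform_eventually[OF h(3)])
    show "u2 \<in> sq_int (LS b R1)" using u f lim by (rule second_component_sq_int)
    have fR: "integrable M2 (\<lambda>x. f x * complex_of_real (R1 x))" using f by (rule sq_int_R1_integrable)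
    then show "set_integrable (LS b R2) (ray b) (\<lambda>x. f x * complex_of_real (R1 x))"
      using integrable_mult_indicator[OF sets.top fR] by (simp add: set_integrable_def)
    have I: "(LINT x:ray b|M2. f x * complex_of_real (R1 x)) = (LINT x|M2. f x * complex_of_real (R1 x))"
      using set_integral_space[OF fR] by (simp only: S2.space_LS)
    show u1_lim: "(u1 \<longlongrightarrow> u1 0 + (LINT x:ray b|LS b R2. f x * complex_of_real (R1 x))) (at_end b)"
      unfolding I using u f lim by (rule first_component_tendsto)
    show "((\<lambda>x. u1 x * u2 x) \<longlongrightarrow> 0) (at_end b)"
      using tendsto_mult[OF u1_lim lim] by simp
  next
    fix u1 u2 f
    assume "(u1, u2, f) \<in> triples b R1 R2" "singular_at_end b R1 R2" "((\<lambda>x. u1 x * u2 x) \<longlongrightarrow> 0) (at_end b)"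
    then show "(cls (LS b R2) u1, cls (LS b R2) f) \<in> T_N_adjoint b R1 R2"
      using singular_neumann neumann_in_adjoint by (auto simp: triples_iff)
  qed
qed

end
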